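(* Let $u_D\in H^4(I)^d$, and let $u\in H^4(I)^d$ with $u-u_D\in H^2_D(I)^d$ and $\lambda\in H^2(I)$ satisfy $|u'|^2=1$ on $I$ and $\int_I u''\cdot v''+\lambda\,u'\cdot v'\,dx=0$ for all $v\in H^2_D(I)^d$. Assume that $a_\lambda$ is coercive on $\ker B_u$, i.e. there is $\alpha>0$ with $a_\lambda(v,v)\ge\alpha\|v\|^2_{H^2(I)^d}$ for all $v\in\ker B_u$. Then there exist $h_0>0$ and $c>0$ such that for every mesh with $h\le h_0$ there is $(u_h,\lambda_h)$ with $u_h\in u_{D,h}+\mathcal S^{3,1}_D(\mathcal T_h)^d$, $\lambda_h\in\mathcal S^{2,0}_0(\mathcal T_h)$, $F_h(u_h,\lambda_h)=0$, and $$\|u-u_h\|_{H^2(I)^d}\le c\,h^2.$$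
   Context: Mesh notation: $I=(a,b)\subset\mathbb R$, $a=x_0<x_1<\dots<x_M=b$, $I_i=[x_{i-1},x_i]$, $h_i=x_i-x_{i-1}$, $h=\max_i h_i$, $\mathcal T_h=\{I_1,\dots,I_M\}$. The meshes are quasi-uniform: there is $c>0$ independent of $h$ with $h\le c\,h_i$ for all $i$. Let $m_i=(x_{i-1}+x_i)/2$, $\mathcal N_1(\mathcal T_h)=\{x_0,\dots,x_M\}$, $\mathcal N_2(\mathcal T_h)=\mathcal N_1(\mathcal T_h)\cup\{m_1,\dots,m_M\}$. For $k\ge1$, $l\in\{0,1\}$, $\mathcal S^{k,l}(\mathcal T_h)=\{v\in C^l(\bar I): v|_{I_i}\in\mathcal P_k\ \forall i\}$. $\mathcal I_{h,2}$ is the nodal interpolant into $\mathcal S^{2,0}(\mathcal T_h)$ at $\mathcal N_2(\mathcal T_h)$ (componentwise). $\mathcal I_{h,3}:C^1(\bar I)^d\to\mathcal S^{3,1}(\mathcal T_h)^d$ is the cubic Hermite interpolant: $\mathcal I_{h,3}v(z)=v(z)$, $(\mathcal I_{h,3}v)'(z)=v'(z)$ for all $z\in\mathcal N_1(\mathcal T_h)$. $(\cdot,\cdot)$ is the $L^2(I)$ inner product and $(u,v)_{h,2}=\int_I\mathcal I_{h,2}(u\cdot v)\,dx$. Problem notation: $H^2_D(I)=\{v\in H^2(I):v(a)=0,\ v'(a)=v'(b)=0\}$, $H^1_0(I)=\{v\in H^1(I): v(a)=v(b)=0\}$; $\mathcal S^{3,1}_D(\mathcal T_h)=\mathcal S^{3,1}(\mathcal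 T_h)\cap H^2_D(I)$, $\mathcal S^{2,0}_0(\mathcal T_h)=\mathcal S^{2,0}(\mathcal T_h)\cap H^1_0(I)$, $X_h=\mathcal S^{3,1}_D(\mathcal T_h)^d\times\mathcal S^{2,0}_0(\mathcal T_h)$. Continuous forms: $a_\lambda(v,w)=(v'',w'')+(\lambda,v'\cdot w')$, $\ker B_u=\{v\in H^2_D(I)^d:u'\cdot v'=0\text{ on }I\}$. With $u_{D,h}=\mathcal I_{h,3}u_D$, for $u_h\in u_{D,h}+\mathcal S^{3,1}_D(\mathcal T_h)^d$ and $\lambda_h\in\mathcal S^{2,0}_0(\mathcal T_h)$, $F_h(u_h,\lambda_h)$ is the linear functional on $X_h$ $$F_h(u_h,\lambda_h)[v_h,\mu_h]=\int_I u_h''\cdot v_h''\,dx+(\lambda_h,u_h'\cdot v_h')_{h,2}+\tfrac12(\mu_h,|u_h'|^2-1)_{h,2};$$ $F_h(u_h,\lambda_h)=0$ means it vanishes for all $(v_h,\mu_h)\in X_h$ (equivalently, $u_h$ is stationary for $\frac12\int_I|u_h''|^2$ under the constraint $\mathcal I_{h,2}(|u_h'|^2-1)=0$ with Lagrange multiplier $\lambda_h$). *)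

theory Defs
  imports "HOL-Analysis.Analysis"
begin

text \<open>Derivative (within the closed interval S) of a function of one real variable.
  For Sobolev functions it is the a.e. derivative; values on null sets are irrelevant
  inside Henstock-Kurzweil integrals.\<close>
definition dv :: "real set \<Rightarrow> (real \<Rightarrow> 'a::real_normed_vector) \<Rightarrow> real \<Rightarrow> 'a" where
  "dv S f x = vector_derivative f (at x within S)"

text \<open>f is in H^k(a,b) iff for j < k the j-th derivative is absolutely continuous,
  i.e. it is the integral of its (a.e.) derivative, and the k-th derivative is
  measurable and square integrable. For vector valued f (codomain real^'d) this is
  the space H^k(I)^d.\<close>
definition sobH :: "nat \<Rightarrow> real \<Rightarrow> real \<Rightarrow> (real \<Rightarrow> 'a::euclidean_space) set" where
  "sobH k a b = {f.
     (\<forall>j<k. \<forall>x\<in>{a..b}.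
        ((dv {a..b} ^^ Suc j) f has_integral ((dv {a..b} ^^ j) f x - (dv {a..b} ^^ j) f a)) {a..x})
   \<and> (dv {a..b} ^^ k) f measurable_on {a..b}
   \<and> (\<lambda>x. (norm ((dv {a..b} ^^ k) f x))\<^sup>2) integrable_on {a..b}}"

definition H2norm :: "real \<Rightarrow> real \<Rightarrow> (real \<Rightarrow> 'a::euclidean_space) \<Rightarrow> real" where
  "H2norm a b v = sqrt (integral {a..b} (\<lambda>x. (norm (v x))\<^sup>2 + (norm (dv {a..b} v x))\<^sup>2
                                           + (norm (dv {a..b} (dv {a..b} v) x))\<^sup>2))"

definition H2D :: "real \<Rightarrow> real \<Rightarrow> (real \<Rightarrow> 'a::euclidean_space) set" where
  "H2D a b = {v \<in> sobH 2 a b. v a = 0 \<and> dv {a..b} v a = 0 \<and> dv {a..b} v b = 0}"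

definition H10 :: "real \<Rightarrow> real \<Rightarrow> (real \<Rightarrow> real) set" where
  "H10 a b = {v \<in> sobH 1 a b. v a = 0 \<and> v b = 0}"

definition a_form :: "real \<Rightarrow> real \<Rightarrow> (real \<Rightarrow> real) \<Rightarrow> (real \<Rightarrow> real^'d) \<Rightarrow> (real \<Rightarrow> real^'d) \<Rightarrow> real" where
  "a_form a b lam v w = integral {a..b} (\<lambda>x. dv {a..b} (dv {a..b} v) x \<bullet> dv {a..b} (dv {a..b} w) x
                                             + lam x * (dv {a..b} v x \<bullet> dv {a..b} w x))"

definition kerB :: "real \<Rightarrow> real \<Rightarrow> (real \<Rightarrow> real^'d) \<Rightarrow> (real \<Rightarrow> real^'d) set" where
  "kerB a b u = {v \<in> H2D a b. \<forall>x\<in>{a<..<b}. dv {a..b} u x \<bullet> dv {a..b} v x = 0}"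

definition mesh :: "real \<Rightarrow> real \<Rightarrow> nat \<Rightarrow> (nat \<Rightarrow> real) \<Rightarrow> bool" where
  "mesh a b M x \<longleftrightarrow> M \<ge> 1 \<and> x 0 = a \<and> x M = b \<and> (\<forall>i<M. x i < x (Suc i))"

definition meshsize :: "nat \<Rightarrow> (nat \<Rightarrow> real) \<Rightarrow> real" where
  "meshsize M x = Max {x i - x (i - 1) | i. i \<in> {1..M}}"

definition quasi_uniform :: "real \<Rightarrow> nat \<Rightarrow> (nat \<Rightarrow> real) \<Rightarrow> bool" where
  "quasi_uniform c M x \<longleftrightarrow> (\<forall>i\<in>{1..M}. meshsize M x \<le> c * (x i - x (i - 1)))"

definition nodes1 :: "nat \<Rightarrow> (nat \<Rightarrow> real) \<Rightarrow> real set" where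
  "nodes1 M x = {x i | i. i \<le> M}"

definition nodes2 :: "nat \<Rightarrow> (nat \<Rightarrow> real) \<Rightarrow> real set" where
  "nodes2 M x = nodes1 M x \<union> {(x (i - 1) + x i) / 2 | i. i \<in> {1..M}}"

definition poly_on :: "nat \<Rightarrow> real set \<Rightarrow> (real \<Rightarrow> 'a::real_vector) \<Rightarrow> bool" where
  "poly_on k S f \<longleftrightarrow> (\<exists>c::nat \<Rightarrow> 'a. \<forall>y\<in>S. f y = (\<Sum>j\<le>k. y ^ j *\<^sub>R c j))"

text \<open>S^{k,l}(T_h) for l in {0,1}: C^l on [a,b], polynomial of degree \<le> k on each element.\<close>
definition spline :: "nat \<Rightarrow> nat \<Rightarrow> real \<Rightarrow> real \<Rightarrow> nat \<Rightarrow> (nat \<Rightarrow> real)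
                      \<Rightarrow> (real \<Rightarrow> 'a::euclidean_space) set" where
  "spline k l a b M x = {f.
     (\<forall>i\<in>{1..M}. poly_on k {x (i - 1)..x i} f)
   \<and> continuous_on {a..b} f
   \<and> (l = 1 \<longrightarrow> (\<exists>g. continuous_on {a..b} g \<and>
                     (\<forall>y\<in>{a..b}. (f has_vector_derivative g y) (at y within {a..b}))))}"

definition S31D :: "real \<Rightarrow> real \<Rightarrow> nat \<Rightarrow> (nat \<Rightarrow> real) \<Rightarrow> (real \<Rightarrow> real^'d) set" where
  "S31D a b M x = spline 3 1 a b M x \<inter> H2D a b"

definition S20_0 :: "real \<Rightarrow> real \<Rightarrow> nat \<Rightarrow> (nat \<Rightarrow> real) \<Rightarrow> (real \<Rightarrow> real) set" where
  "S20_0 a b M x = spline 2 0 a b M x \<inter> H10 a b"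

text \<open>Nodal interpolant into S^{2,0} at N_2 (normalised to 0 outside [a,b] so that it is unique).\<close>
definition interp2 :: "real \<Rightarrow> real \<Rightarrow> nat \<Rightarrow> (nat \<Rightarrow> real) \<Rightarrow> (real \<Rightarrow> real) \<Rightarrow> real \<Rightarrow> real" where
  "interp2 a b M x f = (THE w. w \<in> spline 2 0 a b M x \<and> (\<forall>z\<in>nodes2 M x. w z = f z)
                               \<and> (\<forall>y. y \<notin> {a..b} \<longrightarrow> w y = 0))"

text \<open>Cubic Hermite interpolant into S^{3,1} (normalised to 0 outside [a,b]).\<close>
definition herm3 :: "real \<Rightarrow> real \<Rightarrow> nat \<Rightarrow> (nat \<Rightarrow> real) \<Rightarrow> (real \<Rightarrow> 'a::euclidean_space) \<Rightarrow> real \<Rightarrow> 'a" where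
  "herm3 a b M x f = (THE w. w \<in> spline 3 1 a b M x
                      \<and> (\<forall>z\<in>nodes1 M x. w z = f z \<and> dv {a..b} w z = dv {a..b} f z)
                      \<and> (\<forall>y. y \<notin> {a..b} \<longrightarrow> w y = 0))"

definition ip2 :: "real \<Rightarrow> real \<Rightarrow> nat \<Rightarrow> (nat \<Rightarrow> real) \<Rightarrow> (real \<Rightarrow> real) \<Rightarrow> (real \<Rightarrow> real) \<Rightarrow> real" where
  "ip2 a b M x u v = integral {a..b} (interp2 a b M x (\<lambda>y. u y * v y))"

definition Fh :: "real \<Rightarrow> real \<Rightarrow> nat \<Rightarrow> (nat \<Rightarrow> real) \<Rightarrow> (real \<Rightarrow> real^'d) \<Rightarrow> (real \<Rightarrow> real)
                  \<Rightarrow> (real \<Rightarrow> real^'d) \<Rightarrow> (real \<Rightarrow> real) \<Rightarrow> real" where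
  "Fh a b M x uh lh v mu =
     integral {a..b} (\<lambda>y. dv {a..b} (dv {a..b} uh) y \<bullet> dv {a..b} (dv {a..b} v) y)
   + ip2 a b M x lh (\<lambda>y. dv {a..b} uh y \<bullet> dv {a..b} v y)
   + 1/2 * ip2 a b M x mu (\<lambda>y. (norm (dv {a..b} uh y))\<^sup>2 - 1)"

end

(* The tangent p = u' satisfies the Euler-Lagrange equation p'' = lam p and |p| = 1. Differentiating
   |p|^2 = 1 gives lam = -|p'|^2 and that |p'| is a constant k, so p runs along a great circle with
   speed k. The derivatives of S^{3,1}_D are exactly S^{2,0}_0, and the quadrature only sees nodal
   values, so the discrete problem asks for a piecewise quadratic p_h with unit nodal values whose
   Dirichlet energy is stationary. Such a p_h exists explicitly: place its nodes on the same great
   circle, each midpoint halfway (in angle) between its neighbours. The tangential forces at a vertex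
   then balance iff 2 sin(al) (4 - cos(al)) / h takes the same value 3 s on all elements, where al is
   the half-angle of an element of length h; the normal forces are absorbed by the multiplier. Since
   2 sin(al) (4 - cos(al)) = 6 al + O(al^3), the intermediate value theorem yields an s for which the
   angles add up to k (b - a), and then 2 al = k h + O(h^3), which gives the error estimate. *)
theory Submission
  imports Defs
begin

section \<open>Quadratics on one element\<close>

text \<open>The naive candidate, with nodes at the angles \<open>k * (y - a)\<close>, satisfies the
  constraint and has the right accuracy, but on a non-uniform mesh it is in general not stationary:
  its tangential forces depend on the element lengths. The angles must be redistributed, and their
  total has to be exactly \<open>k * (b - a)\<close>, because u' is prescribed at b. Since no value
  of v is prescribed at b, v' carries no mean condition, and testing with v amounts to testing with
  arbitrary interior nodal values of v'. The Simpson weights make the discrete product diagonal in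
  the nodal values. The multiplier is therefore read off node by node, as minus the radial force
  over the weight, and no system has to be solved. A node halfway in angle feels no tangential force
  by symmetry, so only the vertices need balancing. The expression 2 sin(al) (4 - cos(al)) stems
  from the exact energy of an element: the squared chord plus 16/3 times the squared distance of the
  mid-node from the midpoint of the chord, divided by h. The straight line, k = 0, is carried along
  as the degenerate frame with \<open>e2 = 0\<close>.\<close>

lemma dv_eqI:
  assumes "a < b" "y \<in> {a..b}" "(f has_vector_derivative D) (at y within {a..b})"
  shows "dv {a..b} f y = D"
  using assms vector_derivative_within_cbox[of a b y f D] unfolding dv_def by simp

text \<open>\<open>vector_derivative\<close> is a choice over a predicate, and these predicates are
  equivalent for the two functions. The equality therefore persists at points without a derivative,
  such as the vertices for second derivatives of splines.\<close>

lemma dv_cong: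
  assumes "\<And>y. y \<in> S \<Longrightarrow> f y = g y" "y \<in> S"
  shows "dv S f y = dv S g y"
proof -
  have "(f has_vector_derivative D) (at y within S) \<longleftrightarrow> (g has_vector_derivative D) (at y within S)" for D
    using has_vector_derivative_transform[OF assms(2), of f g D]
      has_vector_derivative_transform[OF assms(2), of g f D] assms(1) by auto
  then show ?thesis unfolding dv_def vector_derivative_def by simp
qed

text \<open>Lagrange interpolation of p, q, s at -1, 0, 1 on the reference interval;
  \<open>dquad\<close> is its derivative and \<open>aquad\<close> the antiderivative vanishing at 0.
  The monomial basis lets parity arguments act directly.\<close>

definition quad :: "'a::real_vector \<Rightarrow> 'a \<Rightarrow> 'a \<Rightarrow> real \<Rightarrow> 'a" where
  "quad p q s t = q + (t / 2) *\<^sub>R (s - p) + t\<^sup>2 *\<^sub>R ((1/2) *\<^sub>R (p + s) - q)"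

definition dquad :: "'a::real_vector \<Rightarrow> 'a \<Rightarrow> 'a \<Rightarrow> real \<Rightarrow> 'a" where
  "dquad p q s t = (1/2) *\<^sub>R (s - p) + (2 * t) *\<^sub>R ((1/2) *\<^sub>R (p + s) - q)"

definition aquad :: "'a::real_vector \<Rightarrow> 'a \<Rightarrow> 'a \<Rightarrow> real \<Rightarrow> 'a" where
  "aquad p q s t = t *\<^sub>R q + (t\<^sup>2 / 4) *\<^sub>R (s - p) + (t ^ 3 / 3) *\<^sub>R ((1/2) *\<^sub>R (p + s) - q)"

definition refc :: "real \<Rightarrow> real \<Rightarrow> real \<Rightarrow> real" where
  "refc l r y = (2 * y - l - r) / (r - l)"

lemma refc_simps [simp]:
  assumes "l < r"
  shows "refc l r l = -1" "refc l r r = 1" "refc l r ((l + r) / 2) = 0"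
  using assms by (auto simp: refc_def field_simps)

lemma abs_refc_le: "l < r \<Longrightarrow> y \<in> {l..r} \<Longrightarrow> \<bar>refc l r y\<bar> \<le> 1"
  by (auto simp: refc_def field_simps abs_le_iff)

lemma refc_affine: "refc l r y = (2 / (r - l)) * y + (- (l + r) / (r - l))"
  by (simp add: refc_def diff_divide_distrib add_divide_distrib)

lemma refc_deriv: "l < r \<Longrightarrow> (refc l r has_field_derivative 2 / (r - l)) (at y within S)"
  unfolding refc_affine[abs_def] by (rule derivative_eq_intros refl)+ simp

lemma quad_simps [simp]:
  fixes p q s :: "'a::real_vector"
  shows "quad p q s (-1) = p" "quad p q s 0 = q" "quad p q s 1 = s"
proof -
  have *: "(1/2) *\<^sub>R v + (1/2) *\<^sub>R v = v" for v :: 'a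
    by (metis scaleR_half_double scaleR_right_distrib)
  show "quad p q s (-1) = p" "quad p q s 0 = q" "quad p q s 1 = s"
    using *[of p] *[of s] by (simp_all add: quad_def algebra_simps)
qed

lemma quad_deriv:
  fixes p :: "'a::real_normed_vector"
  assumes "l < r"
  shows "((\<lambda>y. quad p q s (refc l r y)) has_vector_derivative (2 / (r - l)) *\<^sub>R dquad p q s (refc l r y))
           (at y within S)"
proof -
  have "(quad p q s has_vector_derivative dquad p q s t) (at t within T)" for t T
    unfolding quad_def[abs_def] dquad_def
    by (auto intro!: derivative_eq_intros simp: algebra_simps)
  from vector_diff_chain_within[OF refc_deriv[OF assms, unfolded has_real_derivative_iff_has_vector_derivative] this]
  show ?thesis by (simp add: o_def)
qed

lemma aquad_deriv:
  fixes p :: "'a::real_normed_vector"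
  assumes "l < r"
  shows "((\<lambda>y. ((r - l) / 2) *\<^sub>R aquad p q s (refc l r y)) has_vector_derivative quad p q s (refc l r y))
           (at y within S)"
proof -
  have "(aquad p q s has_vector_derivative quad p q s t) (at t within T)" for t T
    unfolding aquad_def[abs_def] quad_def
    by (auto intro!: derivative_eq_intros simp: algebra_simps)
  from vector_diff_chain_within[OF refc_deriv[OF assms, unfolded has_real_derivative_iff_has_vector_derivative] this]
  have "((\<lambda>y. aquad p q s (refc l r y)) has_vector_derivative (2 / (r - l)) *\<^sub>R quad p q s (refc l r y)) (at y within S)"
    by (simp add: o_def)
  from has_vector_derivative_scaleR[OF DERIV_const[of "(r-l)/2"] this]
  show ?thesis using assms by (simp add: scaleR_scaleR del: times_divide_eq_left times_divide_eq_right) (simp add: field_simps)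
qed

lemma quad_cont: "l < r \<Longrightarrow> continuous_on S (\<lambda>y. quad p q s (refc l r y) :: 'a::real_normed_vector)"
  unfolding quad_def refc_def by (auto intro!: continuous_intros)

lemma aquad_diff:
  fixes p :: "'a::euclidean_space"
  shows "aquad p q s 1 - aquad p q s (-1) = (1/3) *\<^sub>R (p + 4 *\<^sub>R q + s)"
  by (rule euclidean_eqI) (simp add: aquad_def inner_simps field_simps)

text \<open>Simpson's rule, which is exact for quadratics.\<close>

lemma quad_integral:
  fixes p :: "'a::euclidean_space"
  assumes "l < r"
  shows "((\<lambda>y. quad p q s (refc l r y)) has_integral ((r - l) / 6) *\<^sub>R (p + 4 *\<^sub>R q + s)) {l..r}"
proof -
  have "((\<lambda>y. quad p q s (refc l r y)) has_integral
      ((r - l) / 2) *\<^sub>R aquad p q s (refc l r r) - ((r - l) / 2) *\<^sub>R aquad p q s (refc l r l)) {l..r}"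
    using assms by (intro fundamental_theorem_of_calculus aquad_deriv) auto
  then show ?thesis using assms
    by (simp add: aquad_diff flip: scaleR_diff_right)
qed

text \<open>The derivative is B + 2 t C with B half the chord and C the offset of the midpoint of
  the chord from the mid-node. The constant and the odd part are orthogonal on [-1,1], so no mixed
  term survives.\<close>

lemma dquad_integral:
  fixes p :: "'a::euclidean_space"
  assumes "l < r"
  shows "((\<lambda>y. ((2 / (r - l)) *\<^sub>R dquad p q s (refc l r y)) \<bullet> ((2 / (r - l)) *\<^sub>R dquad p' q' s' (refc l r y)))
     has_integral (1 / (r - l)) * ((s - p) \<bullet> (s' - p') + (16/3) * (((1/2) *\<^sub>R (p + s) - q) \<bullet> ((1/2) *\<^sub>R (p' + s') - q')))) {l..r}"
proof -
  define h B C B' C' where "h = r - l" and "B = (1/2) *\<^sub>R (s - p)" and "C = (1/2) *\<^sub>R (p + s) - q"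
    and "B' = (1/2) *\<^sub>R (s' - p')" and "C' = (1/2) *\<^sub>R (p' + s') - q'"
  have h: "h > 0" using assms h_def by simp
  let ?t = "refc l r"
  define F where "F y = (2 / h) * (?t y * (B \<bullet> B') + (?t y)\<^sup>2 * (B \<bullet> C' + C \<bullet> B') + (4/3) * ?t y ^ 3 * (C \<bullet> C'))" for y
  have "(F has_vector_derivative ((2 / h) *\<^sub>R (B + (2 * ?t y) *\<^sub>R C)) \<bullet> ((2 / h) *\<^sub>R (B' + (2 * ?t y) *\<^sub>R C'))) (at y within {l..r})" for y
    unfolding F_def has_real_derivative_iff_has_vector_derivative[symmetric]
    apply (rule derivative_eq_intros refc_deriv[OF assms] refl)+
    using h by (simp add: h_def[symmetric] inner_add_left inner_add_right field_simps power2_eq_square)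
  then have "((\<lambda>y. ((2 / h) *\<^sub>R (B + (2 * ?t y) *\<^sub>R C)) \<bullet> ((2 / h) *\<^sub>R (B' + (2 * ?t y) *\<^sub>R C'))) has_integral F r - F l) {l..r}"
    using assms by (intro fundamental_theorem_of_calculus) auto
  moreover have "F r - F l = (1 / h) * ((s - p) \<bullet> (s' - p') + (16/3) * (C \<bullet> C'))"
  proof -
    have "F r - F l = (2 / h) * (2 * (B \<bullet> B') + (8/3) * (C \<bullet> C'))"
      using assms by (simp add: F_def algebra_simps)
    also have "B \<bullet> B' = (1/4) * ((s - p) \<bullet> (s' - p'))" by (simp add: B_def B'_def)
    finally show ?thesis by (simp add: algebra_simps)
  qed
  ultimately show ?thesis unfolding dquad_def h_def B_def B'_def C_def C'_def by simp
qed

lemma poly2_eq_quad: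
  fixes f :: "real \<Rightarrow> 'a::euclidean_space"
  assumes "poly_on 2 {l..r} f" "l < r" "y \<in> {l..r}"
  shows "f y = quad (f l) (f ((l + r) / 2)) (f r) (refc l r y)"
proof -
  obtain c where c: "\<And>y. y \<in> {l..r} \<Longrightarrow> f y = (\<Sum>j\<le>2. y ^ j *\<^sub>R c j)"
    using assms(1) unfolding poly_on_def by blast
  have c': "f y = c 0 + y *\<^sub>R c 1 + y\<^sup>2 *\<^sub>R c 2" if "y \<in> {l..r}" for y
    using c[OF that] by (simp add: numeral_2_eq_2)
  \<comment> \<open>Centre m and half-length k turn the claim into a polynomial identity in m, k and
    t, without divisions by \<open>r - l\<close>.\<close>
  define t k m where "t = refc l r y" and "k = (r - l) / 2" and "m = (l + r) / 2"
  have y: "y = m + t * k" "l = m - k" "r = m + k"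
    using assms(2) unfolding t_def k_def m_def refc_def by (auto simp: field_simps)
  have "(l + r) / 2 = m" by (simp add: m_def)
  have f: "f y = c 0 + (m + t * k) *\<^sub>R c 1 + (m + t * k)\<^sup>2 *\<^sub>R c 2"
    "f l = c 0 + (m - k) *\<^sub>R c 1 + (m - k)\<^sup>2 *\<^sub>R c 2"
    "f r = c 0 + (m + k) *\<^sub>R c 1 + (m + k)\<^sup>2 *\<^sub>R c 2" "f m = c 0 + m *\<^sub>R c 1 + m\<^sup>2 *\<^sub>R c 2"
    using assms c'[of y] c'[of l] c'[of r] c'[of m] unfolding y[symmetric] by (simp_all add: m_def)
  show ?thesis unfolding \<open>(l + r) / 2 = m\<close> t_def[symmetric]
  proof (rule euclidean_eqI)
    fix e :: 'a assume "e \<in> Basis"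
    show "f y \<bullet> e = quad (f l) (f m) (f r) t \<bullet> e"
 unfolding f quad_def by (simp add: inner_simps field_simps power2_eq_square)
  qed
qed

section \<open>Closure properties of polynomials of bounded degree\<close>

lemma poly_on_const: "poly_on k S (\<lambda>_. c)"
proof -
  have "\<forall>y\<in>S. c = (\<Sum>j\<le>k. y ^ j *\<^sub>R (if j = 0 then c else 0))"
    by (auto simp: if_distrib[of "scaleR _"] cong: if_cong)
  then show ?thesis unfolding poly_on_def by (intro exI[of _ "\<lambda>j. if j = 0 then c else 0"])
qed

lemma poly_on_add:
  assumes "poly_on k S f" "poly_on k S g" shows "poly_on k S (\<lambda>y. f y + g y)"
proof -
  obtain c d where "\<forall>y\<in>S. f y = (\<Sum>j\<le>k. y ^ j *\<^sub>R c j)" "\<forall>y\<in>S. g y = (\<Sum>j\<le>k. y ^ j *\<^sub>R d j)"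
    using assms unfolding poly_on_def by auto
  then have "\<forall>y\<in>S. f y + g y = (\<Sum>j\<le>k. y ^ j *\<^sub>R (c j + d j))"
    by (simp add: sum.distrib scaleR_add_right)
  then show ?thesis unfolding poly_on_def by (intro exI[of _ "\<lambda>j. c j + d j"])
qed

lemma poly_on_scaleR:
  assumes "poly_on k S f" shows "poly_on k S (\<lambda>y. r *\<^sub>R f y)"
proof -
  obtain c where "\<forall>y\<in>S. f y = (\<Sum>j\<le>k. y ^ j *\<^sub>R c j)"
    using assms unfolding poly_on_def by auto
  then have "\<forall>y\<in>S. r *\<^sub>R f y = (\<Sum>j\<le>k. y ^ j *\<^sub>R (r *\<^sub>R c j))"
    by (simp add: scaleR_sum_right mult.commute)
  then show ?thesis unfolding poly_on_def by (intro exI[of _ "\<lambda>j. r *\<^sub>R c j"])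
qed

lemma poly_on_diff:
  assumes "poly_on k S f" "poly_on k S g" shows "poly_on k S (\<lambda>y. f y - g y)"
  using poly_on_add[OF assms(1) poly_on_scaleR[OF assms(2), of "-1"]] by simp

lemma poly_on_Suc:
  assumes "poly_on k S f" shows "poly_on (Suc k) S f"
proof -
  obtain c where c: "\<forall>y\<in>S. f y = (\<Sum>j\<le>k. y ^ j *\<^sub>R c j)"
    using assms unfolding poly_on_def by auto
  have "\<forall>y\<in>S. f y = (\<Sum>j\<le>Suc k. y ^ j *\<^sub>R (if j \<le> k then c j else 0))"
    using c by simp
  then show ?thesis unfolding poly_on_def by (intro exI[of _ "\<lambda>j. if j \<le> k then c j else 0"])
qed

lemma poly_on_times:
  assumes "poly_on k S f" shows "poly_on (Suc k) S (\<lambda>y. y *\<^sub>R f y)"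
proof -
  obtain c where "\<forall>y\<in>S. f y = (\<Sum>j\<le>k. y ^ j *\<^sub>R c j)"
    using assms unfolding poly_on_def by auto
  then have "\<forall>y\<in>S. y *\<^sub>R f y = (\<Sum>j\<le>Suc k. y ^ j *\<^sub>R (if j = 0 then 0 else c (j - 1)))"
    unfolding sum.atMost_Suc_shift by (simp add: scaleR_sum_right)
  then show ?thesis unfolding poly_on_def by (intro exI[of _ "\<lambda>j. if j = 0 then 0 else c (j - 1)"])
qed

lemma poly_on_refc:
  assumes "poly_on k S f" shows "poly_on (Suc k) S (\<lambda>y. refc l r y *\<^sub>R f y)"
  using poly_on_add[OF poly_on_scaleR[OF poly_on_times[OF assms]] poly_on_scaleR[OF poly_on_Suc[OF assms]],
      of "2 / (r - l)" "- (l + r) / (r - l)"]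
  unfolding refc_affine by (simp add: scaleR_left_distrib)

lemma poly_on_quad: "poly_on 2 S (\<lambda>y. quad p q s (refc l r y))"
proof -
  have "quad p q s t = q + t *\<^sub>R ((1/2) *\<^sub>R (s - p) + t *\<^sub>R ((1/2) *\<^sub>R (p + s) - q))" for t
    by (simp add: quad_def algebra_simps power2_eq_square)
  then show ?thesis unfolding numeral_2_eq_2
    by (auto intro!: poly_on_add poly_on_refc poly_on_const)
qed

lemma poly_on_aquad: "poly_on 3 S (\<lambda>y. k *\<^sub>R aquad p q s (refc l r y))"
proof -
  have "aquad p q s t = t *\<^sub>R (q + t *\<^sub>R ((1/4) *\<^sub>R (s - p) + t *\<^sub>R ((1/3) *\<^sub>R ((1/2) *\<^sub>R (p + s) - q))))" for t
    by (simp add: aquad_def algebra_simps power2_eq_square power3_eq_cube)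
  then show ?thesis unfolding numeral_3_eq_3
    by (simp only:) (intro poly_on_scaleR poly_on_add poly_on_refc poly_on_const)
qed

lemma poly_on_cong: "(\<And>y. y \<in> S \<Longrightarrow> f y = g y) \<Longrightarrow> poly_on k S f \<longleftrightarrow> poly_on k S g"
  unfolding poly_on_def by auto

lemma poly3_deriv:
  fixes f :: "real \<Rightarrow> 'a::real_normed_vector"
  assumes "poly_on 3 S f"
  obtains g where "poly_on 2 S g" "\<And>y. y \<in> S \<Longrightarrow> (f has_vector_derivative g y) (at y within S)"
proof -
  obtain c where c: "\<And>y. y \<in> S \<Longrightarrow> f y = (\<Sum>j\<le>3. y ^ j *\<^sub>R c j)"
    using assms unfolding poly_on_def by blast
  have f: "f y = c 0 + y *\<^sub>R c 1 + y\<^sup>2 *\<^sub>R c 2 + y ^ 3 *\<^sub>R c 3" if "y \<in> S" for y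
    using c[OF that] by (simp add: numeral_3_eq_3 numeral_2_eq_2)
  define g where "g y = c 1 + (2 * y) *\<^sub>R c 2 + (3 * y\<^sup>2) *\<^sub>R c 3" for y
  have "g y = (\<Sum>j\<le>2. y ^ j *\<^sub>R (real (Suc j) *\<^sub>R c (Suc j)))" for y
    by (simp add: g_def eval_nat_numeral algebra_simps flip: scaleR_left_distrib)
  then have 1: "poly_on 2 S g" unfolding poly_on_def by metis
  have "((\<lambda>y. c 0 + y *\<^sub>R c 1 + y\<^sup>2 *\<^sub>R c 2 + y ^ 3 *\<^sub>R c 3) has_vector_derivative g y) (at y within S)" for y
    unfolding g_def by (auto intro!: derivative_eq_intros)
  then have "(f has_vector_derivative g y) (at y within S)" if "y \<in> S" for y
    using has_vector_derivative_transform[OF that, of f "\<lambda>y. c 0 + y *\<^sub>R c 1 + y\<^sup>2 *\<^sub>R c 2 + y ^ 3 *\<^sub>R c 3"] f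
    by blast
  with 1 that show ?thesis by blast
qed

section \<open>Piecewise polynomials on a mesh\<close>

locale grid =
  fixes a b :: real and M :: nat and x :: "nat \<Rightarrow> real"
  assumes grid: "mesh a b M x"
begin

lemma M_pos: "M \<ge> 1" and x_0: "x 0 = a" and x_M: "x M = b"
  and step: "i < M \<Longrightarrow> x i < x (Suc i)"
  using grid by (auto simp: mesh_def)

lemma x_less: "i < j \<Longrightarrow> j \<le> M \<Longrightarrow> x i < x j"
proof (induction j)
  case (Suc j)
  then show ?case using step[of j] by (cases "i = j") auto
qed simp

lemma x_le: "i \<le> j \<Longrightarrow> j \<le> M \<Longrightarrow> x i \<le> x j"
  using x_less[of i j] by (cases "i = j") auto

lemma ab: "a < b"
  using x_less[of 0 M] M_pos x_0 x_M by simp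

lemma x_in: "i \<le> M \<Longrightarrow> x i \<in> {a..b}"
  using x_le[of 0 i] x_le[of i M] x_0 x_M by simp

lemma elem_sub: "i < M \<Longrightarrow> {x i..x (Suc i)} \<subseteq> {a..b}"
  using x_in[of i] x_in[of "Suc i"] by auto

abbreviation mid :: "nat \<Rightarrow> real" where "mid i \<equiv> (x i + x (Suc i)) / 2"
abbreviation elt :: "nat \<Rightarrow> real set" where "elt i \<equiv> {x i..x (Suc i)}"
abbreviation h :: "nat \<Rightarrow> real" where "h i \<equiv> x (Suc i) - x i"
abbreviation ref :: "nat \<Rightarrow> real \<Rightarrow> real" where "ref i \<equiv> refc (x i) (x (Suc i))"

lemma mid_in: "i < M \<Longrightarrow> mid i \<in> elt i"
  using step[of i] by auto

lemma sum_h: "n \<le> M \<Longrightarrow> (\<Sum>i<n. h i) = x n - a"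
  using sum_lessThan_telescope[of x n] x_0 by simp

lemma meshsize_ge: "i < M \<Longrightarrow> h i \<le> meshsize M x"
proof -
  assume "i < M"
  have "{x i - x (i - 1) | i. i \<in> {1..M}} = (\<lambda>i. x i - x (i - 1)) ` {1..M}" by auto
  then have "finite {x i - x (i - 1) | i. i \<in> {1..M}}" by simp
  moreover have "h i \<in> {x i - x (i - 1) | i. i \<in> {1..M}}"
    using \<open>i < M\<close> by (auto intro!: exI[of _ "Suc i"])
  ultimately show ?thesis unfolding meshsize_def by (rule Max_ge)
qed

lemma all_elements: "(\<forall>i\<in>{1..M}. P (i - 1) i) \<longleftrightarrow> (\<forall>i<M. P i (Suc i))"
proof
  assume L: "\<forall>i\<in>{1..M}. P (i - 1) i"
  show "\<forall>i<M. P i (Suc i)"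
  proof (intro allI impI)
    fix i assume "i < M"
    then show "P i (Suc i)" using L[rule_format, of "Suc i"] by simp
  qed
next
  assume R: "\<forall>i<M. P i (Suc i)"
  show "\<forall>i\<in>{1..M}. P (i - 1) i"
  proof
    fix i assume "i \<in> {1..M}"
    then have "i - 1 < M" "Suc (i - 1) = i" by auto
    then show "P (i - 1) i" using R by metis
  qed
qed

lemma nodes2_iff: "(\<forall>z\<in>nodes2 M x. P z) \<longleftrightarrow> (\<forall>i\<le>M. P (x i)) \<and> (\<forall>i<M. P (mid i))"
proof -
  have "(\<forall>z\<in>nodes2 M x. P z) \<longleftrightarrow> (\<forall>i\<le>M. P (x i)) \<and> (\<forall>i\<in>{1..M}. P ((x (i - 1) + x i) / 2))"
    unfolding nodes2_def nodes1_def by blast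
  then show ?thesis using all_elements[of "\<lambda>i j. P ((x i + x j) / 2)"] by simp
qed

lemma nodes1_iff: "(\<forall>z\<in>nodes1 M x. P z) \<longleftrightarrow> (\<forall>i\<le>M. P (x i))"
  unfolding nodes1_def by auto

lemma elem_cases:
  assumes "y \<in> {a..b}" obtains i where "i < M" "y \<in> elt i"
proof -
  have "n \<le> M \<Longrightarrow> y \<in> {x 0..x n} \<Longrightarrow> n \<ge> 1 \<Longrightarrow> \<exists>i<n. y \<in> elt i" for n
  proof (induction n)
    case (Suc n)
    show ?case
    proof (cases "y \<le> x n \<and> n \<ge> 1")
      case True
      then show ?thesis using Suc by (auto simp: less_Suc_eq)
    next
      case False
      then have "y \<in> elt n" using Suc.prems by (cases n) auto
      then show ?thesis by blast
    qed
  qed simp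
  from this[of M] show ?thesis using that assms M_pos x_0 x_M by auto
qed

text \<open>The finite exceptional set: derivatives of piecewise quadratics may jump here, and all
  integrals ignore it.\<close>

definition vertices :: "real set" where "vertices = x ` {..M}"

lemma finite_vertices: "finite vertices" by (simp add: vertices_def)

lemma open_elem_cases:
  assumes "y \<in> {a..b}" "y \<notin> vertices"
  obtains i where "i < M" "y \<in> {x i<..<x (Suc i)}"
proof -
  obtain i where i: "i < M" "y \<in> elt i" using elem_cases[OF assms(1)] .
  moreover have "y \<noteq> x i" "y \<noteq> x (Suc i)" using assms(2) i by (auto simp: vertices_def)
  ultimately show ?thesis using that by auto
qed

text \<open>Elements that are open on the left partition (a,b], so \<open>LEAST\<close> selects the
  element of a point without ambiguity at shared vertices.\<close>

lemma elem_unique: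
  assumes "i < M" "y \<in> {x i<..x (Suc i)}" shows "(LEAST j. y \<le> x (Suc j)) = i"
proof (rule Least_equality)
  fix j assume "y \<le> x (Suc j)"
  show "i \<le> j"
  proof (rule ccontr)
    assume "\<not> i \<le> j"
    then have "x (Suc j) \<le> x i" using assms x_le[of "Suc j" i] by simp
    then show False using \<open>y \<le> x (Suc j)\<close> assms by auto
  qed
qed (use assms in auto)

section \<open>Gluing integrals and continuity across elements\<close>

lemma has_integral_elements:
  fixes f :: "real \<Rightarrow> 'b::banach"
  assumes "\<And>i. i < M \<Longrightarrow> (f has_integral I i) (elt i)"
  shows "(f has_integral (\<Sum>i<M. I i)) {a..b}"
proof -
  have "n \<le> M \<Longrightarrow> (f has_integral (\<Sum>i<n. I i)) {x 0..x n}" for n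
  proof (induction n)
    case (Suc n)
    then show ?case
      using has_integral_combine[of "x 0" "x n" "x (Suc n)" f "\<Sum>i<n. I i" "I n"] assms[of n] x_le[of 0 n] x_le[of n "Suc n"]
      by simp
  qed (use has_integral_refl(2)[of f "x 0"] in simp)
  from this[of M] show ?thesis using x_0 x_M by simp
qed

lemma continuous_on_elements:
  fixes f :: "real \<Rightarrow> 'b::topological_space"
  assumes "\<And>i. i < M \<Longrightarrow> continuous_on (elt i) f"
  shows "continuous_on {a..b} f"
proof -
  have "n \<le> M \<Longrightarrow> continuous_on {x 0..x n} f" for n
  proof (induction n)
    case (Suc n)
    have "{x 0..x (Suc n)} = {x 0..x n} \<union> elt n"
      using Suc.prems x_le[of 0 n] x_le[of n "Suc n"] by auto
    then show ?case using Suc assms[of n] by (simp add: continuous_on_closed_Un)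
  qed simp
  from this[of M] show ?thesis using x_0 x_M by simp
qed

text \<open>Piecewise quadratic with the nodal values \<open>f (x i)\<close>, \<open>f (mid i)\<close>; continuity across the
  vertices is built in since \<open>f\<close> takes a single value there.\<close>
definition p2 :: "(real \<Rightarrow> 'b::real_vector) \<Rightarrow> bool" where
  "p2 f \<longleftrightarrow> (\<forall>i<M. \<forall>y\<in>elt i. f y = quad (f (x i)) (f (mid i)) (f (x (Suc i))) (ref i y))"

lemma p2D: "p2 f \<Longrightarrow> i < M \<Longrightarrow> y \<in> elt i \<Longrightarrow> f y = quad (f (x i)) (f (mid i)) (f (x (Suc i))) (ref i y)"
  unfolding p2_def by blast

lemma p2_cong_imp:
  assumes "\<And>y. y \<in> {a..b} \<Longrightarrow> f y = g y" "p2 f" shows "p2 g"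
  unfolding p2_def
proof (intro allI impI ballI)
  fix i y assume i: "i < M" "y \<in> elt i"
  have "x i \<in> {a..b}" "x (Suc i) \<in> {a..b}" "mid i \<in> {a..b}" "y \<in> {a..b}"
    using elem_sub[OF i(1)] mid_in[OF i(1)] i x_in[of i] x_in[of "Suc i"] by auto
  from assms(1)[OF this(1)] assms(1)[OF this(2)] assms(1)[OF this(3)] assms(1)[OF this(4)]
  show "g y = quad (g (x i)) (g (mid i)) (g (x (Suc i))) (ref i y)"
    using p2D[OF assms(2) i] by simp
qed

lemma p2_continuous:
  fixes f :: "real \<Rightarrow> 'b::real_normed_vector"
  assumes "p2 f" shows "continuous_on {a..b} f"
proof (rule continuous_on_elements)
  fix i assume i: "i < M"
  have "continuous_on (elt i) (\<lambda>y. quad (f (x i)) (f (mid i)) (f (x (Suc i))) (ref i y))"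
    by (rule quad_cont[OF step[OF i]])
  then show "continuous_on (elt i) f"
    by (rule continuous_on_eq) (rule p2D[OF assms i, symmetric])
qed

lemma spline2_p2: "f \<in> spline 2 l a b M x \<Longrightarrow> p2 f"
  unfolding spline_def p2_def using all_elements[of "\<lambda>i j. poly_on 2 {x i..x j} f"]
  by (auto intro!: poly2_eq_quad step)

lemma p2_spline2: "p2 f \<Longrightarrow> f \<in> spline 2 0 a b M x"
proof -
  assume f: "p2 f"
  have "poly_on 2 (elt i) f" if "i < M" for i
    using poly_on_quad[of "elt i"] by (subst poly_on_cong[OF p2D[OF f that]])
  then show ?thesis
    unfolding spline_def using all_elements[of "\<lambda>i j. poly_on 2 {x i..x j} f"] p2_continuous[OF f] by simp
qed

lemma p2_exists:
  fixes V Q :: "nat \<Rightarrow> 'b::real_vector"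
  obtains f where "p2 f" "\<And>i. i \<le> M \<Longrightarrow> f (x i) = V i" "\<And>i. i < M \<Longrightarrow> f (mid i) = Q i"
    "\<And>y. y \<notin> {a..b} \<Longrightarrow> f y = 0"
proof -
  define f where "f y = (if y \<in> {a..b} then let i = LEAST i. y \<le> x (Suc i) in
      quad (V i) (Q i) (V (Suc i)) (ref i y) else 0)" for y
  have f1: "f y = quad (V i) (Q i) (V (Suc i)) (ref i y)" if "i < M" "y \<in> {x i<..x (Suc i)}" for i y
    using elem_unique[OF that] elem_sub[OF that(1)] that unfolding f_def Let_def by auto
  have f2: "f (x i) = V i" if "i \<le> M" for i
  proof (cases i)
    case 0
    \<comment> \<open>The point \<open>x 0\<close> lies in no element open on the left, but
      \<open>LEAST\<close> still assigns it to element 0.\<close>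
    have "(LEAST i. x 0 \<le> x (Suc i)) = 0"
      using step[of 0] M_pos by (intro Least_equality) auto
    then show ?thesis using 0 x_in[of 0] step[of 0] M_pos by (simp add: f_def)
  next
    case (Suc j)
    then show ?thesis using f1[of j "x i"] step[of j] that by simp
  qed
  have f3: "f y = quad (V i) (Q i) (V (Suc i)) (ref i y)" if "i < M" "y \<in> elt i" for i y
    using f1[OF that(1), of y] f2[of i] that step[OF that(1)] by (cases "y = x i") auto
  have f4: "f (mid i) = Q i" if "i < M" for i
    using f3[OF that mid_in[OF that]] step[OF that] by simp
  have "p2 f" unfolding p2_def
  proof (intro allI impI ballI)
    fix i y assume i: "i < M" "y \<in> elt i"
    show "f y = quad (f (x i)) (f (mid i)) (f (x (Suc i))) (ref i y)"
      using f3[OF i] f2[of i] f2[of "Suc i"] f4[of i] i by (simp only: Suc_le_eq less_imp_le)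
  qed
  moreover have "f y = 0" if "y \<notin> {a..b}" for y using that by (simp only: f_def if_False)
  ultimately show ?thesis using that[of f] f2 f4 by blast
qed

lemma p2_eqI:
  assumes "p2 f" "p2 g" "\<And>i. i \<le> M \<Longrightarrow> f (x i) = g (x i)" "\<And>i. i < M \<Longrightarrow> f (mid i) = g (mid i)" "y \<in> {a..b}"
  shows "f y = g y"
proof -
  obtain i where "i < M" "y \<in> elt i" using elem_cases[OF assms(5)] .
  then show ?thesis using p2D[OF assms(1), of i y] p2D[OF assms(2), of i y] assms(3)[of i] assms(3)[of "Suc i"] assms(4)[of i]
    by (simp only: Suc_le_eq less_imp_le)
qed

lemma p2_integral:
  fixes f :: "real \<Rightarrow> 'b::euclidean_space"
  assumes "p2 f"
  shows p2_integral_element: "i < M \<Longrightarrow> (f has_integral (h i / 6) *\<^sub>R (f (x i) + 4 *\<^sub>R f (mid i) + f (x (Suc i)))) (elt i)"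
    and "integral {a..b} f = (\<Sum>i<M. (h i / 6) *\<^sub>R (f (x i) + 4 *\<^sub>R f (mid i) + f (x (Suc i))))"
proof -
  show *: "i < M \<Longrightarrow> (f has_integral (h i / 6) *\<^sub>R (f (x i) + 4 *\<^sub>R f (mid i) + f (x (Suc i)))) (elt i)" for i
    using quad_integral[OF step] by (subst has_integral_cong[OF p2D[OF assms]])
  show "integral {a..b} f = (\<Sum>i<M. (h i / 6) *\<^sub>R (f (x i) + 4 *\<^sub>R f (mid i) + f (x (Suc i))))"
    using has_integral_elements[of f, OF *] by (rule integral_unique)
qed

text \<open>The definite description is legitimate: three values determine the quadratic on each
  element, neighbours share the value at their common vertex, and values off [a,b] are fixed to
  0.\<close>

lemma interp2_eq:
  shows "p2 (interp2 a b M x f)" and "\<forall>z\<in>nodes2 M x. interp2 a b M x f z = f z"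
proof -
  let ?P = "\<lambda>w. w \<in> spline 2 0 a b M x \<and> (\<forall>z\<in>nodes2 M x. w z = f z) \<and> (\<forall>y. y \<notin> {a..b} \<longrightarrow> w y = 0)"
  obtain w :: "real \<Rightarrow> real" where w: "p2 w" "\<And>i. i \<le> M \<Longrightarrow> w (x i) = f (x i)" "\<And>i. i < M \<Longrightarrow> w (mid i) = f (mid i)"
    "\<And>y. y \<notin> {a..b} \<Longrightarrow> w y = 0" using p2_exists[of "\<lambda>i. f (x i)" "\<lambda>i. f (mid i)"] by blast
  have "?P w" using p2_spline2[OF w(1)] w nodes2_iff[of "\<lambda>z. w z = f z"] by simp
  moreover have "v = w" if "?P v" for v
  proof
    fix y
    have "p2 v" using that spline2_p2 by blast
    then show "v y = w y"
      using that w p2_eqI[of v w y] nodes2_iff[of "\<lambda>z. v z = f z"] by (cases "y \<in> {a..b}") auto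
  qed
  ultimately have "?P (interp2 a b M x f)" unfolding interp2_def by (rule theI)
  then show "p2 (interp2 a b M x f)" "\<forall>z\<in>nodes2 M x. interp2 a b M x f z = f z"
    using spline2_p2 by auto
qed

text \<open>The composite Simpson rule; each nodal value enters separately, with weight h/6 per
  adjacent element at vertices and 4h/6 at midpoints.\<close>

lemma interp2_integral:
  "integral {a..b} (interp2 a b M x f) = (\<Sum>i<M. (h i / 6) * (f (x i) + 4 * f (mid i) + f (x (Suc i))))"
  using p2_integral(2)[OF interp2_eq(1), of f] interp2_eq(2)[unfolded nodes2_iff, of f] by simp

section \<open>Derivatives of piecewise quadratics away from the vertices\<close>

lemma p2_deriv:
  fixes f :: "real \<Rightarrow> 'b::real_normed_vector"
  assumes "p2 f" "i < M" "y \<in> {x i<..<x (Suc i)}"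
  shows "(f has_vector_derivative (2 / h i) *\<^sub>R dquad (f (x i)) (f (mid i)) (f (x (Suc i))) (ref i y)) (at y within S)"
  by (rule has_vector_derivative_at_within, rule has_vector_derivative_transform_within_open[OF quad_deriv[OF step[OF assms(2)]] _ assms(3)])
     (simp, rule p2D[OF assms(1,2), symmetric], auto)

lemma p2_dv:
  fixes f :: "real \<Rightarrow> 'b::real_normed_vector"
  assumes "p2 f" "i < M" "y \<in> {x i<..<x (Suc i)}"
  shows "dv {a..b} f y = (2 / h i) *\<^sub>R dquad (f (x i)) (f (mid i)) (f (x (Suc i))) (ref i y)"
  using p2_deriv[OF assms] elem_sub[OF assms(2)] assms(3) by (intro dv_eqI[OF ab]) auto

lemma p2_has_deriv_dv:
  fixes f :: "real \<Rightarrow> 'b::real_normed_vector"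
  assumes "p2 f" "y \<in> {a..b}" "y \<notin> vertices"
  shows "(f has_vector_derivative dv {a..b} f y) (at y within S)"
proof -
  obtain i where i: "i < M" "y \<in> {x i<..<x (Suc i)}" using open_elem_cases[OF assms(2,3)] .
  show ?thesis using p2_deriv[OF assms(1) i] p2_dv[OF assms(1) i] by simp
qed

text \<open>For a continuous primitive the fundamental theorem tolerates a finite set without
  derivative, so the jumps at the vertices do no harm.\<close>

lemma p2_ftc:
  fixes f :: "real \<Rightarrow> 'b::euclidean_space"
  assumes "p2 f" "{c..d} \<subseteq> {a..b}" "c \<le> d"
  shows "(dv {a..b} f has_integral f d - f c) {c..d}"
  using assms p2_has_deriv_dv[OF assms(1)] continuous_on_subset[OF p2_continuous[OF assms(1)] assms(2)]
  by (intro fundamental_theorem_of_calculus_strong[OF finite_vertices]) auto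

lemma p2_dv_inner:
  fixes f g :: "real \<Rightarrow> 'b::euclidean_space"
  assumes "p2 f" "p2 g" "i < M"
  shows "((\<lambda>y. dv {a..b} f y \<bullet> dv {a..b} g y) has_integral
     (1 / h i) * ((f (x (Suc i)) - f (x i)) \<bullet> (g (x (Suc i)) - g (x i))
        + (16/3) * (((1/2) *\<^sub>R (f (x i) + f (x (Suc i))) - f (mid i)) \<bullet> ((1/2) *\<^sub>R (g (x i) + g (x (Suc i))) - g (mid i))))) (elt i)"
  by (rule has_integral_spike_finite[OF _ _ dquad_integral[OF step[OF assms(3)]], of "{x i, x (Suc i)}"])
     (use p2_dv[OF assms(1,3)] p2_dv[OF assms(2,3)] in auto)

lemma p2_sobH1:
  fixes f :: "real \<Rightarrow> 'b::euclidean_space"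
  assumes "p2 f"
  shows "dv {a..b} f measurable_on {a..b}" "(\<lambda>y. (norm (dv {a..b} f y))\<^sup>2) integrable_on {a..b}" "f \<in> sobH 1 a b"
proof -
  have "dv {a..b} f integrable_on {a..b}" using p2_ftc[OF assms order_refl] ab by (auto simp: integrable_on_def)
  then show 1: "dv {a..b} f measurable_on {a..b}"
    using integrable_imp_measurable measurable_on_iff_borel_measurable[of "{a..b}"] by auto
  show 2: "(\<lambda>y. (norm (dv {a..b} f y))\<^sup>2) integrable_on {a..b}"
    using has_integral_elements[OF p2_dv_inner[OF assms assms]] unfolding power2_norm_eq_inner by (auto simp: integrable_on_def)
  show "f \<in> sobH 1 a b" unfolding sobH_def using 1 2 p2_ftc[OF assms] by auto
qed

section \<open>Cubic splines described through their derivatives\<close>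

lemma quad_diff: "quad (p - p') (q - q') (s - s') t = quad p q s t - quad p' q' s' t"
  by (simp add: quad_def algebra_simps)

lemma p2_diff: "p2 f \<Longrightarrow> p2 g \<Longrightarrow> p2 (\<lambda>y. f y - g y)"
  unfolding p2_def[of "\<lambda>y. f y - g y"] quad_diff
  by (intro allI impI ballI arg_cong2[where f = minus] p2D)

text \<open>The derivative within [a,b] exists at the vertices too and restricts to each closed
  element, where uniqueness of derivatives identifies it with the derivative of the cubic.\<close>

lemma spline31D:
  fixes f :: "real \<Rightarrow> 'b::euclidean_space"
  assumes "f \<in> spline 3 1 a b M x"
  shows spline31_deriv: "y \<in> {a..b} \<Longrightarrow> (f has_vector_derivative dv {a..b} f y) (at y within {a..b})"
    and spline31_p2: "p2 (dv {a..b} f)"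
proof -
  obtain g where g: "continuous_on {a..b} g" "\<And>y. y \<in> {a..b} \<Longrightarrow> (f has_vector_derivative g y) (at y within {a..b})"
    using assms unfolding spline_def by auto
  have gd: "dv {a..b} f y = g y" if "y \<in> {a..b}" for y
    using g(2) that dv_eqI[OF ab] by blast
  show "y \<in> {a..b} \<Longrightarrow> (f has_vector_derivative dv {a..b} f y) (at y within {a..b})" for y
    using g(2) gd by simp
  have "poly_on 2 (elt i) g" if i: "i < M" for i
  proof -
    have "poly_on 3 (elt i) f" using assms all_elements[of "\<lambda>i j. poly_on 3 {x i..x j} f"] i unfolding spline_def by auto
    then obtain k where k: "poly_on 2 (elt i) k" "\<And>y. y \<in> elt i \<Longrightarrow> (f has_vector_derivative k y) (at y within elt i)"
      using poly3_deriv by blast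
    have "g y = k y" if y: "y \<in> elt i" for y
    proof -
      have "(f has_vector_derivative g y) (at y within elt i)"
        using g(2)[of y] elem_sub[OF i] y has_vector_derivative_within_subset by blast
      then show ?thesis using dv_eqI[OF step[OF i] y] k(2)[OF y] by metis
    qed
    then show ?thesis using k(1) poly_on_cong[of "elt i" g k] by simp
  qed
  then have "p2 g" unfolding p2_def by (auto intro!: poly2_eq_quad step)
  then show "p2 (dv {a..b} f)" by (rule p2_cong_imp[rotated]) (simp add: gd)
qed

lemma spline31_diff:
  fixes f g :: "real \<Rightarrow> 'b::euclidean_space"
  assumes "f \<in> spline 3 1 a b M x" "g \<in> spline 3 1 a b M x"
  shows "(\<lambda>y. f y - g y) \<in> spline 3 1 a b M x"
    and "y \<in> {a..b} \<Longrightarrow> dv {a..b} (\<lambda>y. f y - g y) y = dv {a..b} f y - dv {a..b} g y"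
proof -
  have d: "((\<lambda>y. f y - g y) has_vector_derivative dv {a..b} f y - dv {a..b} g y) (at y within {a..b})" if "y \<in> {a..b}" for y
    using assms that by (intro has_vector_derivative_diff spline31_deriv) auto
  show "y \<in> {a..b} \<Longrightarrow> dv {a..b} (\<lambda>y. f y - g y) y = dv {a..b} f y - dv {a..b} g y"
    using dv_eqI[OF ab _ d] by blast
  have "continuous_on {a..b} (\<lambda>y. dv {a..b} f y - dv {a..b} g y)"
    using p2_continuous[OF p2_diff[OF spline31_p2[OF assms(1)] spline31_p2[OF assms(2)]]] .
  then show "(\<lambda>y. f y - g y) \<in> spline 3 1 a b M x"
    using assms d unfolding spline_def by (auto intro!: poly_on_diff continuous_intros)
qed

lemma spline31_H2D:
  fixes f :: "real \<Rightarrow> 'b::euclidean_space"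
  assumes "f \<in> spline 3 1 a b M x" "f a = 0" "dv {a..b} f a = 0" "dv {a..b} f b = 0"
  shows "f \<in> H2D a b"
proof -
  note p = spline31_p2[OF assms(1)]
  have "(dv {a..b} f has_integral f y - f a) {a..y}" if "y \<in> {a..b}" for y
    using that by (intro fundamental_theorem_of_calculus)
      (auto intro!: has_vector_derivative_within_subset[OF spline31_deriv[OF assms(1)], of _ "{a..y}"])
  moreover have "(dv {a..b} (dv {a..b} f) has_integral dv {a..b} f y - dv {a..b} f a) {a..y}" if "y \<in> {a..b}" for y
    using that by (intro p2_ftc[OF p]) auto
  ultimately show ?thesis using p2_sobH1[OF p] assms
    unfolding H2D_def sobH_def by (auto simp: numeral_2_eq_2 less_Suc_eq)
qed

text \<open>Converse of \<open>spline31_p2\<close>: integrating a piecewise quadratic gives a C^1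
  cubic spline with free initial value. Splines can thus be constructed by choosing nodal values of
  the derivative.\<close>

lemma p2_antiderivative:
  fixes f :: "real \<Rightarrow> 'b::euclidean_space" and c :: 'b
  assumes "p2 f"
  defines "U \<equiv> \<lambda>y. c + integral {a..y} f"
  shows "U a = c" "y \<in> {a..b} \<Longrightarrow> (U has_vector_derivative f y) (at y within {a..b})"
    "y \<in> {a..b} \<Longrightarrow> dv {a..b} U y = f y" "U \<in> spline 3 1 a b M x"
    "i < M \<Longrightarrow> U (x (Suc i)) - U (x i) = (h i / 6) *\<^sub>R (f (x i) + 4 *\<^sub>R f (mid i) + f (x (Suc i)))"
proof -
  note cont = p2_continuous[OF assms(1)]
  show "U a = c" by (simp add: U_def)
  show d: "(U has_vector_derivative f y) (at y within {a..b})" if "y \<in> {a..b}" for y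
    unfolding U_def using integral_has_vector_derivative[OF cont that]
    by (auto intro!: derivative_eq_intros)
  show "y \<in> {a..b} \<Longrightarrow> dv {a..b} U y = f y" using dv_eqI[OF ab _ d] by blast
  have inc: "(f has_integral U z - U y) {y..z}" if "y \<in> {a..b}" "z \<in> {a..b}" "y \<le> z" for y z
    using that by (intro fundamental_theorem_of_calculus)
      (auto intro!: has_vector_derivative_within_subset[OF d, of _ "{y..z}"])
  show "i < M \<Longrightarrow> U (x (Suc i)) - U (x i) = (h i / 6) *\<^sub>R (f (x i) + 4 *\<^sub>R f (mid i) + f (x (Suc i)))"
    using inc[of "x i" "x (Suc i)"] p2_integral_element[OF assms(1)] x_in[of i] x_in[of "Suc i"] step[of i]
    by (auto intro: has_integral_unique)
  have "poly_on 3 (elt i) U" if i: "i < M" for i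
  proof -
    define A where "A y = (h i / 2) *\<^sub>R aquad (f (x i)) (f (mid i)) (f (x (Suc i))) (ref i y)" for y
    have "U y = U (x i) - A (x i) + A y" if y: "y \<in> elt i" for y
    proof -
      have "((\<lambda>y. quad (f (x i)) (f (mid i)) (f (x (Suc i))) (ref i y)) has_integral A y - A (x i)) {x i..y}"
        unfolding A_def using y step[OF i] by (intro fundamental_theorem_of_calculus aquad_deriv) auto
      then have "(f has_integral A y - A (x i)) {x i..y}"
      proof (rule has_integral_eq[rotated])
        fix z assume "z \<in> {x i..y}"
        then show "quad (f (x i)) (f (mid i)) (f (x (Suc i))) (ref i z) = f z"
          using y by (intro p2D[OF assms(1) i, symmetric]) auto
      qed
      moreover have "(f has_integral U y - U (x i)) {x i..y}"
        using y elem_sub[OF i] x_in[of i] i by (intro inc) auto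
      ultimately have "A y - A (x i) = U y - U (x i)" by (rule has_integral_unique)
      then show ?thesis by (simp add: algebra_simps)
    qed
    moreover have "poly_on 3 (elt i) (\<lambda>y. U (x i) - A (x i) + A y)"
      unfolding A_def by (intro poly_on_add poly_on_const poly_on_aquad)
    ultimately show ?thesis by (rule poly_on_cong[THEN iffD2])
  qed
  moreover have "continuous_on {a..b} U"
    using d by (rule continuous_on_vector_derivative)
  ultimately show "U \<in> spline 3 1 a b M x"
    unfolding spline_def using all_elements[of "\<lambda>i j. poly_on 3 {x i..x j} U"] d cont by auto
qed

text \<open>Existence starts from the derivative: the vertex slopes are given, and the midpoint
  slope \<open>Q i\<close> solves Simpson's rule for the prescribed increment of f. For uniqueness,
  the same rule shows that a difference with zero data has zero midpoint slopes, so its derivative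
  vanishes.\<close>

lemma herm3_eq:
  fixes f :: "real \<Rightarrow> 'b::euclidean_space"
  shows "herm3 a b M x f \<in> spline 3 1 a b M x"
    "i \<le> M \<Longrightarrow> herm3 a b M x f (x i) = f (x i)"
    "i \<le> M \<Longrightarrow> dv {a..b} (herm3 a b M x f) (x i) = dv {a..b} f (x i)"
proof -
  let ?d = "dv {a..b}"
  let ?P = "\<lambda>w. w \<in> spline 3 1 a b M x \<and> (\<forall>z\<in>nodes1 M x. w z = f z \<and> ?d w z = ?d f z)
     \<and> (\<forall>y. y \<notin> {a..b} \<longrightarrow> w y = 0)"
  define Q where "Q i = (1/4) *\<^sub>R ((6 / h i) *\<^sub>R (f (x (Suc i)) - f (x i)) - ?d f (x i) - ?d f (x (Suc i)))" for i
  obtain g :: "real \<Rightarrow> 'b" where g: "p2 g" "\<And>i. i \<le> M \<Longrightarrow> g (x i) = ?d f (x i)"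
    "\<And>i. i < M \<Longrightarrow> g (mid i) = Q i" "\<And>y. y \<notin> {a..b} \<Longrightarrow> g y = 0"
    by (rule p2_exists[of "\<lambda>i. ?d f (x i)" Q]) blast
  define U where "U y = f a + integral {a..y} g" for y
  note U = p2_antiderivative[OF g(1), where c = "f a", folded U_def]
  have Ux: "i \<le> M \<Longrightarrow> U (x i) = f (x i)" for i
  proof (induction i)
    case 0
    then show ?case using U(1) x_0 by simp
  next
    case (Suc i)
    then have i: "i < M" "U (x i) = f (x i)" by auto
    have "g (x i) + 4 *\<^sub>R g (mid i) + g (x (Suc i)) = (6 / h i) *\<^sub>R (f (x (Suc i)) - f (x i))"
      using g(2)[of i] g(2)[of "Suc i"] g(3)[of i] i by (simp add: Q_def)
    then have "U (x (Suc i)) - f (x i) = (h i / 6) *\<^sub>R (6 / h i) *\<^sub>R (f (x (Suc i)) - f (x i))"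
      using U(5)[OF i(1)] i(2) by simp
    moreover have "(h i / 6) * (6 / h i) = 1" using step[OF i(1)] by simp
    ultimately have "U (x (Suc i)) - f (x i) = f (x (Suc i)) - f (x i)" by (metis scaleR_scaleR scaleR_one)
    then show ?case by simp
  qed
  define w where "w y = (if y \<in> {a..b} then U y else 0)" for y
  have wd: "(w has_vector_derivative g y) (at y within {a..b})" if "y \<in> {a..b}" for y
    by (rule has_vector_derivative_transform[OF that _ U(2)[OF that]]) (simp add: w_def)
  have "poly_on 3 (elt i) w" if "i < M" for i
  proof -
    have "poly_on 3 (elt i) U" using U(4) all_elements[of "\<lambda>i j. poly_on 3 {x i..x j} U"] that unfolding spline_def by auto
    then show ?thesis using poly_on_cong[of "elt i" w U] elem_sub[OF that] by (auto simp: w_def)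
  qed
  moreover have "continuous_on {a..b} w" using wd by (rule continuous_on_vector_derivative)
  ultimately have "w \<in> spline 3 1 a b M x"
    unfolding spline_def using all_elements[of "\<lambda>i j. poly_on 3 {x i..x j} w"] wd p2_continuous[OF g(1)] by auto
  moreover have "w (x i) = f (x i)" "?d w (x i) = ?d f (x i)" if "i \<le> M" for i
    using that Ux x_in[OF that] g(2) dv_eqI[OF ab x_in[OF that] wd[OF x_in[OF that]]] by (auto simp: w_def)
  ultimately have Pw: "?P w" unfolding nodes1_iff by (simp add: w_def)
  have uniq: "v = w" if "?P v" for v
  proof
    fix y
    have v: "v \<in> spline 3 1 a b M x" "\<And>i. i \<le> M \<Longrightarrow> v (x i) = f (x i)" "\<And>i. i \<le> M \<Longrightarrow> ?d v (x i) = ?d f (x i)"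
      using that unfolding nodes1_iff by auto
    have w: "w \<in> spline 3 1 a b M x" "\<And>i. i \<le> M \<Longrightarrow> w (x i) = f (x i)" "\<And>i. i \<le> M \<Longrightarrow> ?d w (x i) = ?d f (x i)"
      using Pw unfolding nodes1_iff by auto
    define e where "e y = v y - w y" for y
    have e: "e \<in> spline 3 1 a b M x" "\<And>y. y \<in> {a..b} \<Longrightarrow> ?d e y = ?d v y - ?d w y"
      unfolding e_def[abs_def] using spline31_diff[OF v(1) w(1)] by auto
    note ep = spline31_p2[OF e(1)]
    have ex: "e (x i) = 0" "?d e (x i) = 0" if "i \<le> M" for i
      using e(2)[OF x_in[OF that]] v w that by (auto simp: e_def)
    have em: "?d e (mid i) = 0" if i: "i < M" for i
    proof -
      have "(?d e has_integral e (x (Suc i)) - e (x i)) (elt i)"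
        using step[OF i] elem_sub[OF i]
        by (intro fundamental_theorem_of_calculus) (auto intro!: has_vector_derivative_within_subset[OF spline31_deriv[OF e(1)], of _ "elt i"])
      from has_integral_unique[OF this p2_integral_element[OF ep i]] show ?thesis
        using ex i step[OF i] by simp
    qed
    have "?d e y = 0" if "y \<in> {a..b}" for y
      using p2_eqI[OF ep, of "\<lambda>_. 0" y] ex em that by (auto simp: p2_def quad_def)
    then have "\<And>y. y \<in> {a..b} \<Longrightarrow> (e has_vector_derivative 0) (at y within {a..b})"
      using spline31_deriv[OF e(1)] by fastforce
    from has_vector_derivative_zero_constant[OF _ this]
    obtain k where "\<And>y. y \<in> {a..b} \<Longrightarrow> e y = k" by auto
    then have "e y = 0" if "y \<in> {a..b}" for y using ex(1)[of 0] x_in[of 0] that by force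
    then show "v y = w y" using that Pw unfolding e_def by (cases "y \<in> {a..b}") auto
  qed
  have "?P (herm3 a b M x f)" unfolding herm3_def by (rule theI[of ?P, OF Pw uniq])
  then show "herm3 a b M x f \<in> spline 3 1 a b M x" "i \<le> M \<Longrightarrow> herm3 a b M x f (x i) = f (x i)"
    "i \<le> M \<Longrightarrow> dv {a..b} (herm3 a b M x f) (x i) = dv {a..b} f (x i)"
    unfolding nodes1_iff by auto
qed

end

section \<open>The continuous problem\<close>

text \<open>Orthonormality is left out on purpose: for k = 0 the frame has \<open>e2 = 0\<close>,
  and the addition and derivative formulas hold for arbitrary vectors.\<close>

definition circ :: "'a::real_vector \<Rightarrow> 'a \<Rightarrow> real \<Rightarrow> 'a" where
  "circ e1 e2 \<theta> = cos \<theta> *\<^sub>R e1 + sin \<theta> *\<^sub>R e2"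

definition tang :: "'a::real_vector \<Rightarrow> 'a \<Rightarrow> real \<Rightarrow> 'a" where
  "tang e1 e2 \<theta> = cos \<theta> *\<^sub>R e2 - sin \<theta> *\<^sub>R e1"

lemma circ_add: "circ e1 e2 (\<phi> + \<theta>) = cos \<theta> *\<^sub>R circ e1 e2 \<phi> + sin \<theta> *\<^sub>R tang e1 e2 \<phi>"
  by (simp add: circ_def tang_def cos_add sin_add algebra_simps)

lemma tang_add: "tang e1 e2 (\<phi> + \<theta>) = cos \<theta> *\<^sub>R tang e1 e2 \<phi> - sin \<theta> *\<^sub>R circ e1 e2 \<phi>"
  by (simp add: circ_def tang_def cos_add sin_add algebra_simps)

lemma circ_0 [simp]: "circ e1 e2 0 = e1" and tang_0 [simp]: "tang e1 e2 0 = e2"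
  by (simp_all add: circ_def tang_def)

lemma circ_deriv:
  fixes e1 e2 :: "'a::real_normed_vector"
  shows "((\<lambda>y. circ e1 e2 (k * (y - a))) has_vector_derivative k *\<^sub>R tang e1 e2 (k * (y - a))) (at y within S)"
  unfolding circ_def tang_def
  by (auto intro!: derivative_eq_intros simp: algebra_simps)

lemma tang_deriv:
  fixes e1 e2 :: "'a::real_normed_vector"
  shows "((\<lambda>y. tang e1 e2 (k * (y - a))) has_vector_derivative - k *\<^sub>R circ e1 e2 (k * (y - a))) (at y within S)"
  unfolding circ_def tang_def
  by (auto intro!: derivative_eq_intros simp: algebra_simps)

section \<open>From the weak equation to classical derivatives\<close>

lemma sobH_continuous_on:
  fixes f :: "real \<Rightarrow> 'a::euclidean_space"
  assumes "a < b" "f \<in> sobH k a b" "j < k"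
  shows "continuous_on {a..b} ((dv {a..b} ^^ j) f)"
proof -
  let ?g = "(dv {a..b} ^^ j) f" and ?d = "(dv {a..b} ^^ Suc j) f"
  have i: "(?d has_integral ?g y - ?g a) {a..y}" if "y \<in> {a..b}" for y
    using assms that unfolding sobH_def by blast
  have "?d integrable_on {a..b}" using i[of b] assms(1) by (auto simp: integrable_on_def)
  then have "continuous_on {a..b} (\<lambda>y. ?g a + integral {a..y} ?d)"
    by (intro continuous_intros indefinite_integral_continuous_1)
  then show ?thesis
    by (rule continuous_on_eq) (use integral_unique[OF i] in simp)
qed

text \<open>With one derivative to spare, derivative j + 1 is continuous, so the integral identity
  in \<open>sobH\<close> yields a classical derivative at every point, endpoints included.\<close>

lemma sobH_has_vector_derivative:
  fixes f :: "real \<Rightarrow> 'a::euclidean_space"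
  assumes "a < b" "f \<in> sobH k a b" "Suc j < k" "y \<in> {a..b}"
  shows "((dv {a..b} ^^ j) f has_vector_derivative (dv {a..b} ^^ Suc j) f y) (at y within {a..b})"
proof -
  let ?g = "(dv {a..b} ^^ j) f" and ?d = "(dv {a..b} ^^ Suc j) f"
  have i: "(?d has_integral ?g y - ?g a) {a..y}" if "y \<in> {a..b}" for y
    using assms(2,3) that unfolding sobH_def by (auto dest: Suc_lessD)
  have "((\<lambda>y. integral {a..y} ?d) has_vector_derivative ?d y) (at y within {a..b})"
    by (rule integral_has_vector_derivative[OF sobH_continuous_on[OF assms(1-3)] assms(4)])
  then have "((\<lambda>y. ?g a + integral {a..y} ?d) has_vector_derivative ?d y) (at y within {a..b})"
    by (auto intro!: derivative_eq_intros)
  moreover have "?g y = ?g a + integral {a..y} ?d" if "y \<in> {a..b}" for y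
    using integral_unique[OF i[OF that]] by simp
  ultimately show ?thesis
    using has_vector_derivative_transform[OF assms(4), of ?g "\<lambda>y. ?g a + integral {a..y} ?d"] by blast
qed

lemma C2_H2D:
  fixes v w z :: "real \<Rightarrow> 'a::euclidean_space"
  assumes "a < b"
    and v: "\<And>y. y \<in> {a..b} \<Longrightarrow> (v has_vector_derivative w y) (at y within {a..b})"
    and w: "\<And>y. y \<in> {a..b} \<Longrightarrow> (w has_vector_derivative z y) (at y within {a..b})"
    and z: "continuous_on {a..b} z" and bc: "v a = 0" "w a = 0" "w b = 0"
  shows "v \<in> H2D a b" "\<And>y. y \<in> {a..b} \<Longrightarrow> dv {a..b} v y = w y" "\<And>y. y \<in> {a..b} \<Longrightarrow> dv {a..b} (dv {a..b} v) y = z y"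
proof -
  let ?d = "dv {a..b}"
  show d1: "?d v y = w y" if "y \<in> {a..b}" for y using dv_eqI[OF assms(1) that v[OF that]] .
  show d2: "?d (?d v) y = z y" if "y \<in> {a..b}" for y
  proof -
    have "?d (?d v) y = ?d w y" by (rule dv_cong[OF d1 that])
    also have "\<dots> = z y" using dv_eqI[OF assms(1) that w[OF that]] .
    finally show ?thesis .
  qed
  have i1: "(?d v has_integral v y - v a) {a..y}" if "y \<in> {a..b}" for y
  proof (rule has_integral_eq)
    show "(w has_integral v y - v a) {a..y}"
      using that by (intro fundamental_theorem_of_calculus)
        (auto intro!: has_vector_derivative_within_subset[OF v, of _ "{a..y}"])
  qed (use that d1 in auto)
  have i2: "(?d (?d v) has_integral ?d v y - ?d v a) {a..y}" if "y \<in> {a..b}" for y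
  proof (rule has_integral_eq)
    have "?d v y = w y" "?d v a = w a" using d1 that by auto
    then show "(z has_integral ?d v y - ?d v a) {a..y}"
      using that by (simp only:) (intro fundamental_theorem_of_calculus,
        auto intro!: has_vector_derivative_within_subset[OF w, of _ "{a..y}"])
  qed (use that d2 in auto)
  have "?d (?d v) integrable_on {a..b}" using i2[of b] assms(1) by (auto simp: integrable_on_def)
  then have m: "?d (?d v) measurable_on {a..b}"
    using integrable_imp_measurable measurable_on_iff_borel_measurable[of "{a..b}"] by auto
  have "(\<lambda>y. (norm (z y))\<^sup>2) integrable_on {a..b}"
    using z by (intro integrable_continuous_real continuous_intros)
  then have s: "(\<lambda>y. (norm (?d (?d v) y))\<^sup>2) integrable_on {a..b}"
    by (rule integrable_eq) (use d2 in simp)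
  show "v \<in> H2D a b"
    using i1 i2 m s bc d1 assms(1) unfolding H2D_def sobH_def by (auto simp: numeral_2_eq_2 less_Suc_eq)
qed

text \<open>Testing with \<open>w = \<integral> z\<close>, where \<open>z\<close> is \<open>q\<close> minus an antiderivative of \<open>lam p\<close> minus its mean,
  forces \<open>z = 0\<close>.\<close>
lemma euler_lagrange:
  fixes p q :: "real \<Rightarrow> 'a::euclidean_space" and lam :: "real \<Rightarrow> real"
  assumes "a < b" and p: "continuous_on {a..b} p" and q: "continuous_on {a..b} q" and lam: "continuous_on {a..b} lam"
    and weak: "\<And>v. v \<in> H2D a b \<Longrightarrow> integral {a..b} (\<lambda>y. q y \<bullet> dv {a..b} (dv {a..b} v) y
                                       + lam y * (p y \<bullet> dv {a..b} v y)) = 0"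
    and "y \<in> {a..b}"
  shows "(q has_vector_derivative lam y *\<^sub>R p y) (at y within {a..b})"
proof -
  define G where "G y = integral {a..y} (\<lambda>t. lam t *\<^sub>R p t)" for y
  define c where "c = (1 / (b - a)) *\<^sub>R integral {a..b} (\<lambda>t. q t - G t)"
  define z where "z y = q y - G y - c" for y
  define w where "w y = integral {a..y} z" for y
  define v where "v y = integral {a..y} w" for y
  have G: "(G has_vector_derivative lam y *\<^sub>R p y) (at y within {a..b})" if "y \<in> {a..b}" for y
    unfolding G_def by (rule integral_has_vector_derivative[OF _ that]) (intro continuous_intros p lam)
  have Gc: "continuous_on {a..b} G" using G by (rule continuous_on_vector_derivative)
  have zc: "continuous_on {a..b} z" unfolding z_def by (intro continuous_intros q Gc)
  have w: "(w has_vector_derivative z y) (at y within {a..b})" if "y \<in> {a..b}" for y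
    unfolding w_def by (rule integral_has_vector_derivative[OF zc that])
  have wc: "continuous_on {a..b} w" using w by (rule continuous_on_vector_derivative)
  have v: "(v has_vector_derivative w y) (at y within {a..b})" if "y \<in> {a..b}" for y
    unfolding v_def by (rule integral_has_vector_derivative[OF wc that])
  have "w b = integral {a..b} (\<lambda>t. q t - G t) - integral {a..b} (\<lambda>t. c)"
    unfolding w_def z_def by (intro integral_diff integrable_continuous_real continuous_intros q Gc)
  also have "\<dots> = 0" using assms(1) by (simp add: c_def)
  finally have w0: "w a = 0" "w b = 0" by (simp_all add: w_def)
  have v0: "v a = 0" by (simp add: v_def)
  have H: "v \<in> H2D a b" "\<And>y. y \<in> {a..b} \<Longrightarrow> dv {a..b} v y = w y" "\<And>y. y \<in> {a..b} \<Longrightarrow> dv {a..b} (dv {a..b} v) y = z y"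
    using C2_H2D[OF assms(1) v w zc v0 w0] by blast+
  have 1: "((\<lambda>y. q y \<bullet> z y + lam y * (p y \<bullet> w y)) has_integral 0) {a..b}"
  proof -
    have "integral {a..b} (\<lambda>y. q y \<bullet> z y + lam y * (p y \<bullet> w y)) = 0"
      using weak[OF H(1)] integral_cong[of "{a..b}" "\<lambda>y. q y \<bullet> dv {a..b} (dv {a..b} v) y + lam y * (p y \<bullet> dv {a..b} v y)"
        "\<lambda>y. q y \<bullet> z y + lam y * (p y \<bullet> w y)"] H(2,3) by simp
    moreover have "(\<lambda>y. q y \<bullet> z y + lam y * (p y \<bullet> w y)) integrable_on {a..b}"
      by (intro integrable_continuous_real continuous_intros p q lam zc wc)
    ultimately show ?thesis using has_integral_integral by metis
  qed
  have 2: "((\<lambda>y. G y \<bullet> z y + lam y * (p y \<bullet> w y)) has_integral G b \<bullet> w b - G a \<bullet> w a) {a..b}"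
  proof (rule fundamental_theorem_of_calculus)
    show "((\<lambda>y. G y \<bullet> w y) has_vector_derivative G y \<bullet> z y + lam y * (p y \<bullet> w y)) (at y within {a..b})" if "y \<in> {a..b}" for y
      using bounded_bilinear.has_vector_derivative[OF bounded_bilinear_inner G[OF that] w[OF that]] by simp
  qed (use assms(1) in simp)
  have 3: "((\<lambda>y. c \<bullet> z y) has_integral c \<bullet> w b - c \<bullet> w a) {a..b}"
  proof (rule fundamental_theorem_of_calculus)
    show "((\<lambda>y. c \<bullet> w y) has_vector_derivative c \<bullet> z y) (at y within {a..b})" if "y \<in> {a..b}" for y
      using bounded_linear.has_vector_derivative[OF bounded_linear_inner_right w[OF that]] .
  qed (use assms(1) in simp)
  \<comment> \<open>The \<open>lam\<close> terms of 1 and 2 cancel, leaving (q - G - c) . z = z . z.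
    Facts 2 and 3 integrate the total derivatives of G . w and c . w, which contribute nothing
    because w vanishes at both ends.\<close>
  have "((\<lambda>y. z y \<bullet> z y) has_integral 0 - (G b \<bullet> w b - G a \<bullet> w a) - (c \<bullet> w b - c \<bullet> w a)) {a..b}"
    by (rule has_integral_eq[OF _ has_integral_diff[OF has_integral_diff[OF 1 2] 3]])
       (simp add: z_def inner_diff_left)
  then have "((\<lambda>y. z y \<bullet> z y) has_integral 0) (cbox a b)" using w0 by simp
  then have z0: "z y = 0" if "y \<in> {a..b}" for y
    using has_integral_0_cbox_imp_0[of a b "\<lambda>y. z y \<bullet> z y" y] zc that assms(1)
    by (auto intro!: continuous_intros)
  have "q y = G y + c" if "y \<in> {a..b}" for y using z0[OF that] by (simp add: z_def algebra_simps)
  moreover have "((\<lambda>y. G y + c) has_vector_derivative lam y *\<^sub>R p y) (at y within {a..b})"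
    using G[OF assms(6)] by (auto intro!: derivative_eq_intros)
  ultimately show ?thesis
    using has_vector_derivative_transform[OF assms(6), of q "\<lambda>y. G y + c"] by blast
qed

lemma constant_within_imp_deriv_0:
  fixes f :: "real \<Rightarrow> real"
  assumes "a < b" "y \<in> {a..b}" "\<And>y. y \<in> {a..b} \<Longrightarrow> f y = c" "(f has_vector_derivative D) (at y within {a..b})"
  shows "D = 0"
proof -
  have "(f has_vector_derivative 0) (at y within {a..b})"
    using has_vector_derivative_transform[OF assms(2), of f "\<lambda>_. c"] assms(3) by auto
  from dv_eqI[OF assms(1,2) this] dv_eqI[OF assms(1,2,4)] show ?thesis by simp
qed

lemma great_circle:
  fixes p q :: "real \<Rightarrow> 'a::euclidean_space" and lam :: "real \<Rightarrow> real"
  assumes ab: "a < b"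
    and p: "\<And>y. y \<in> {a..b} \<Longrightarrow> (p has_vector_derivative q y) (at y within {a..b})"
    and q: "\<And>y. y \<in> {a..b} \<Longrightarrow> (q has_vector_derivative lam y *\<^sub>R p y) (at y within {a..b})"
    and unit: "\<And>y. y \<in> {a<..<b} \<Longrightarrow> norm (p y) = 1"
  obtains k e1 e2 where "k \<ge> 0" "norm e1 = 1" "norm e2 \<le> 1" "e1 \<bullet> e2 = 0" "k = 0 \<or> norm e2 = 1"
    "\<And>y. y \<in> {a..b} \<Longrightarrow> p y = circ e1 e2 (k * (y - a))"
proof -
  note inner_deriv = bounded_bilinear.has_vector_derivative[OF bounded_bilinear_inner]
  have pc: "continuous_on {a..b} p" using p by (rule continuous_on_vector_derivative)
  \<comment> \<open>The constraint is given on the open interval; continuity extends it to the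
    endpoints, where one-sided derivatives are taken as well.\<close>
  have pp: "p y \<bullet> p y = 1" if "y \<in> {a..b}" for y
  proof (rule continuous_constant_on_closure[of "{a<..<b}" "\<lambda>y. p y \<bullet> p y"])
    show "continuous_on (closure {a<..<b}) (\<lambda>y. p y \<bullet> p y)" using ab pc by (auto intro!: continuous_intros)
    show "y \<in> closure {a<..<b}" using ab that by simp
    show "\<And>y. y \<in> {a<..<b} \<Longrightarrow> p y \<bullet> p y = 1" using unit by (simp add: norm_eq_1)
  qed
  have pq: "p y \<bullet> q y = 0" if "y \<in> {a..b}" for y
    using constant_within_imp_deriv_0[OF ab that pp inner_deriv[OF p p]] that by (simp add: inner_commute)
  have lam: "lam y = - (q y \<bullet> q y)" if "y \<in> {a..b}" for y
    using constant_within_imp_deriv_0[OF ab that pq inner_deriv[OF p q]] that pp[OF that] by simp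
  have "((\<lambda>y. q y \<bullet> q y) has_vector_derivative 0) (at y within {a..b})" if "y \<in> {a..b}" for y
    using inner_deriv[OF q[OF that] q[OF that]] pq[OF that] by (simp add: inner_commute)
  from has_vector_derivative_zero_constant[OF convex_closed_interval this]
  obtain K where K: "\<And>y. y \<in> {a..b} \<Longrightarrow> q y \<bullet> q y = K" by blast
  \<comment> \<open>For k = 0 the convention 1 / 0 = 0 makes \<open>e2 = 0\<close>, and
    \<open>k *\<^sub>R e2 = q a\<close> still holds.\<close>
  define k e1 e2 where "k = norm (q a)" and "e1 = p a" and "e2 = (1 / k) *\<^sub>R q a"
  have aab: "a \<in> {a..b}" using ab by simp
  have ke2: "k *\<^sub>R e2 = q a" by (auto simp: e2_def k_def)
  have lk: "lam y = - k\<^sup>2" if "y \<in> {a..b}" for y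
    using lam[OF that] K[OF that] K[OF aab] by (simp add: k_def power2_norm_eq_inner)
  define P Q where "P y = circ e1 e2 (k * (y - a))" and "Q y = k *\<^sub>R tang e1 e2 (k * (y - a))" for y
  have P: "(P has_vector_derivative Q y) (at y within {a..b})" for y
    unfolding P_def Q_def by (rule circ_deriv)
  have Q: "(Q has_vector_derivative - k\<^sup>2 *\<^sub>R P y) (at y within {a..b})" for y
    unfolding P_def Q_def
    using bounded_linear.has_vector_derivative[OF bounded_linear_scaleR_right tang_deriv, of k e1 e2 k a y] by (simp add: power2_eq_square)
  \<comment> \<open>The conserved energy of the oscillator p'' = -k^2 p, taken for the difference of
    two solutions with equal initial data. Its vanishing gives uniqueness.\<close>
  define E where "E y = (q y - Q y) \<bullet> (q y - Q y) + k\<^sup>2 * ((p y - P y) \<bullet> (p y - P y))" for y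
  have dE: "(E has_vector_derivative 0) (at y within {a..b})" if y: "y \<in> {a..b}" for y
  proof -
    have dq: "((\<lambda>y. q y - Q y) has_vector_derivative - k\<^sup>2 *\<^sub>R (p y - P y)) (at y within {a..b})"
      using has_vector_derivative_diff[OF q[OF y] Q[of y]] lk[OF y] by (simp add: algebra_simps)
    have dp: "((\<lambda>y. p y - P y) has_vector_derivative q y - Q y) (at y within {a..b})"
      by (rule has_vector_derivative_diff[OF p[OF y] P])
    show ?thesis unfolding E_def
      using has_vector_derivative_add[OF inner_deriv[OF dq dq]
          has_vector_derivative_mult_right[OF inner_deriv[OF dp dp], of "k\<^sup>2"]]
      by (simp add: inner_commute algebra_simps)
  qed
  have ini: "P a = p a" "Q a = q a" by (simp_all add: P_def Q_def e1_def ke2)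
  from has_vector_derivative_zero_constant[OF convex_closed_interval dE]
  obtain K' where K': "\<And>y. y \<in> {a..b} \<Longrightarrow> E y = K'" by blast
  have E0: "E y = 0" if "y \<in> {a..b}" for y
    using K'[OF that] K'[OF aab] ini by (simp add: E_def)
  have qQ: "q y = Q y" if "y \<in> {a..b}" for y
  proof -
    have "(q y - Q y) \<bullet> (q y - Q y) \<ge> 0" "k\<^sup>2 * ((p y - P y) \<bullet> (p y - P y)) \<ge> 0" by auto
    then have "(q y - Q y) \<bullet> (q y - Q y) = 0" using E0[OF that] unfolding E_def by linarith
    then show ?thesis by simp
  qed
  \<comment> \<open>For k = 0 the energy says nothing about \<open>p - P\<close>, so equality is
    recovered from the derivatives.\<close>
  have "((\<lambda>y. p y - P y) has_vector_derivative 0) (at y within {a..b})" if "y \<in> {a..b}" for y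
    using has_vector_derivative_diff[OF p[OF that] P] qQ[OF that] by simp
  from has_vector_derivative_zero_constant[OF convex_closed_interval this]
  obtain K'' where K'': "\<And>y. y \<in> {a..b} \<Longrightarrow> p y - P y = K''" by blast
  have pP: "p y = P y" if "y \<in> {a..b}" for y
    using K''[OF that] K''[OF aab] ini by simp
  show ?thesis
  proof (rule that)
    show "norm e1 = 1" using pp[OF aab] by (simp add: e1_def norm_eq_1)
    show "k = 0 \<or> norm e2 = 1" "norm e2 \<le> 1" by (auto simp: e2_def k_def)
    show "e1 \<bullet> e2 = 0" using pq[OF aab] by (simp add: e1_def e2_def)
    show "0 \<le> k" by (simp add: k_def)
    show "p y = circ e1 e2 (k * (y - a))" if "y \<in> {a..b}" for y
      using pP[OF that] by (simp only: P_def)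
  qed
qed

section \<open>Arcs and their quadratic interpolants\<close>

text \<open>Proportional to the derivative of the Dirichlet energy of an element, of half-angle \<open>\<alpha>\<close>, with
  respect to that angle.\<close>
definition arc_force :: "real \<Rightarrow> real" where
  "arc_force \<alpha> = 2 * sin \<alpha> * (4 - cos \<alpha>)"

section \<open>Bounds for the force function and its inversion\<close>

lemma arc_force_deriv: "(arc_force has_real_derivative 8 * cos \<alpha> - 4 * (cos \<alpha>)\<^sup>2 + 2) (at \<alpha>)"
proof -
  have "(arc_force has_real_derivative 2 * (cos \<alpha> * (4 - cos \<alpha>)) + 2 * (sin \<alpha>)\<^sup>2) (at \<alpha>)"
    unfolding arc_force_def[abs_def] by (auto intro!: derivative_eq_intros simp: power2_eq_square algebra_simps)
  moreover have "2 * (cos \<alpha> * (4 - cos \<alpha>)) + 2 * (sin \<alpha>)\<^sup>2 = 8 * cos \<alpha> - 4 * (cos \<alpha>)\<^sup>2 + 2"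
    unfolding sin_squared_eq by (simp add: power2_eq_square algebra_simps)
  ultimately show ?thesis by simp
qed

text \<open>The defect has derivative 4 (cos t - 1)^2, a perfect square.\<close>

lemma arc_force_le: "0 \<le> \<alpha> \<Longrightarrow> arc_force \<alpha> \<le> 6 * \<alpha>"
proof -
  assume "0 \<le> \<alpha>"
  have "6 * 0 - arc_force 0 \<le> 6 * \<alpha> - arc_force \<alpha>"
  proof (rule DERIV_nonneg_imp_nondecreasing[OF \<open>0 \<le> \<alpha>\<close>], intro exI conjI)
    fix t
    show "((\<lambda>t. 6 * t - arc_force t) has_real_derivative 4 * (cos t - 1)\<^sup>2) (at t)"
      by (auto intro!: derivative_eq_intros arc_force_deriv simp: power2_eq_square algebra_simps)
  qed simp
  then show ?thesis by (simp add: arc_force_def)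
qed

lemma abs_sin_diff_le: "\<bar>sin t - t\<bar> \<le> \<bar>t\<bar> ^ 3 / 6" for t :: real
  using Maclaurin_sin_bound[of t 3] by (simp add: eval_nat_numeral sin_coeff_def)

lemma one_minus_cos_le: "1 - cos t \<le> t\<^sup>2 / 2" for t :: real
proof -
  have "1 - cos t = 2 * (sin (t / 2))\<^sup>2" using cos_double_sin[of "t / 2"] by simp
  also have "\<dots> \<le> 2 * (t / 2)\<^sup>2"
    using abs_sin_x_le_abs_x[of "t / 2"] unfolding abs_le_square_iff by simp
  finally show ?thesis by (simp add: power2_eq_square)
qed

text \<open>In the form 8 sin \<alpha> - sin(2 \<alpha>), the cubic Taylor bound for the first term
  gives the coefficient 8/6 = 4/3.\<close>

lemma arc_force_ge: "0 \<le> \<alpha> \<Longrightarrow> 6 * \<alpha> - 4 / 3 * \<alpha> ^ 3 \<le> arc_force \<alpha>"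
proof -
  assume a: "0 \<le> \<alpha>"
  have "arc_force \<alpha> = 8 * sin \<alpha> - sin (2 * \<alpha>)" by (simp only: arc_force_def sin_double) (simp add: algebra_simps)
  moreover have "sin \<alpha> \<ge> \<alpha> - \<alpha> ^ 3 / 6" using abs_sin_diff_le[of \<alpha>] unfolding abs_of_nonneg[OF a] by linarith
  moreover have "sin (2 * \<alpha>) \<le> 2 * \<alpha>" using a by (simp add: sin_x_le_x)
  ultimately show ?thesis by linarith
qed

text \<open>Below 1 < pi/2 the cosine is nonnegative, so cos^2 is at most cos and the derivative is
  at least 4 cos + 2 > 0.\<close>

lemma arc_force_strict_mono: "0 \<le> s \<Longrightarrow> s < t \<Longrightarrow> t \<le> 1 \<Longrightarrow> arc_force s < arc_force t"
proof (rule DERIV_pos_imp_increasing[of s t arc_force])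
  fix r assume *: "s \<le> r" "r \<le> t" "0 \<le> s" "t \<le> 1"
  have "cos r \<ge> 0" using * pi_gt3 by (intro cos_ge_zero) auto
  moreover have "(cos r)\<^sup>2 \<le> 1" by (simp add: abs_square_le_1)
  moreover have "cos r * cos r \<le> cos r * 1" by (intro mult_left_mono) (use \<open>cos r \<ge> 0\<close> in auto)
  ultimately have "0 < 8 * cos r - 4 * (cos r)\<^sup>2 + 2" by (simp add: power2_eq_square)
  then show "\<exists>y. (arc_force has_real_derivative y) (at r) \<and> 0 < y" using arc_force_deriv by blast
qed auto

text \<open>The range covers [0,4] because \<open>arc_force 1\<close> is at least 6 - 4/3; only
  arguments 3 s h up to 3 will occur. Continuity of the inverse comes from compactness of
  [0,1].\<close>

lemma arc_force_inverse:
  obtains D where "continuous_on {0..4} D" "\<And>t. t \<in> {0..4} \<Longrightarrow> D t \<in> {0..1} \<and> arc_force (D t) = t"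
proof -
  have gc: "continuous_on {0..1} arc_force" unfolding arc_force_def[abs_def] by (intro continuous_intros)
  have inj: "inj_on arc_force {0..1}"
    by (rule linorder_inj_onI) (use arc_force_strict_mono in force)+
  have "continuous_on (arc_force ` {0..1}) (the_inv_into {0..1} arc_force)"
    by (rule continuous_on_inv_into[OF gc compact_Icc inj])
  moreover have sub: "{0..4} \<subseteq> arc_force ` {0..1}"
  proof
    fix t :: real assume "t \<in> {0..4}"
    moreover have "arc_force 0 = 0" "arc_force 1 \<ge> 4" using arc_force_ge[of 1] by (simp_all add: arc_force_def)
    ultimately obtain r where "0 \<le> r" "r \<le> 1" "arc_force r = t"
      using IVT'[of arc_force 0 t 1] gc by auto
    then show "t \<in> arc_force ` {0..1}" by auto
  qed
  ultimately have "continuous_on {0..4} (the_inv_into {0..1} arc_force)" using continuous_on_subset by blast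
  moreover have "the_inv_into {0..1} arc_force t \<in> {0..1} \<and> arc_force (the_inv_into {0..1} arc_force t) = t" if "t \<in> {0..4}" for t
    using sub that the_inv_into_into[OF inj _ order_refl, of t] f_the_inv_into_f[OF inj, of t] by blast
  ultimately show ?thesis using that by blast
qed

text \<open>The slope of \<open>arc_force\<close> at 0 is 6, so the factor 3 makes s an approximate
  angular speed: 2 \<alpha> is close to s h. From arc_force \<alpha> \<le> 6 \<alpha> the total
  angle at s = k is already large enough, which places s in [0,k]. Both 2 \<alpha> and k h then lie
  between s h and s h + k^3 H^2 h, and this is the final estimate.\<close>

lemma equilibrium_angles:
  fixes h :: "nat \<Rightarrow> real"
  assumes k: "k \<ge> 0" and h: "\<And>i. i < M \<Longrightarrow> 0 < h i \<and> h i \<le> H" and M: "M \<ge> 1" and kH: "k * H \<le> 1"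
  obtains s \<alpha> where "\<And>i. i < M \<Longrightarrow> arc_force (\<alpha> i) = 3 * s * h i"
    "\<And>i. i < M \<Longrightarrow> 0 \<le> \<alpha> i \<and> \<alpha> i \<le> 1 \<and> \<alpha> i \<le> k * h i"
    "(\<Sum>i<M. 2 * \<alpha> i) = k * (\<Sum>i<M. h i)"
    "\<And>i. i < M \<Longrightarrow> \<bar>2 * \<alpha> i - k * h i\<bar> \<le> k ^ 3 * H\<^sup>2 * h i"
proof -
  obtain D where D: "continuous_on {0..4} D" "\<And>t. t \<in> {0..4} \<Longrightarrow> D t \<in> {0..1} \<and> arc_force (D t) = t"
    by (rule arc_force_inverse) blast
  define L where "L = (\<Sum>i<M. h i)"
  have L: "L > 0" unfolding L_def using h M by (intro sum_pos) (auto simp: lessThan_empty_iff)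
  have rng: "3 * s * h i \<in> {0..4}" if "s \<in> {0..k}" "i < M" for s i
  proof -
    have "s * h i \<le> k * H" using that h[OF that(2)] by (intro mult_mono) auto
    moreover have "0 \<le> s * h i" using that h[OF that(2)] by simp
    ultimately show ?thesis using kH by auto
  qed
  define \<Phi> where "\<Phi> s = (\<Sum>i<M. 2 * D (3 * s * h i))" for s
  have lower: "s * h i \<le> 2 * D (3 * s * h i)" if "s \<in> {0..k}" "i < M" for s i
    using D(2)[OF rng[OF that]] arc_force_le[of "D (3 * s * h i)"] by simp
  have D0: "D 0 = 0"
  proof (rule ccontr)
    assume "D 0 \<noteq> 0"
    then show False using D(2)[of 0] arc_force_strict_mono[of 0 "D 0"] by (auto simp: arc_force_def[of 0])
  qed
  have "\<exists>s\<ge>0. s \<le> k \<and> \<Phi> s = k * L"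
  proof (rule IVT')
    show "\<Phi> 0 \<le> k * L" using D0 k L by (simp add: \<Phi>_def)
    show "k * L \<le> \<Phi> k" unfolding \<Phi>_def L_def sum_distrib_left using k by (intro sum_mono lower) auto
    show "continuous_on {0..k} \<Phi>" unfolding \<Phi>_def
      by (intro continuous_intros continuous_on_compose2[OF D(1)]) (use rng in auto)
  qed (rule k)
  then obtain s where s: "s \<in> {0..k}" "\<Phi> s = k * L" by auto
  define \<alpha> where "\<alpha> i = D (3 * s * h i)" for i
  have g: "arc_force (\<alpha> i) = 3 * s * h i" "0 \<le> \<alpha> i" "\<alpha> i \<le> 1" "s * h i \<le> 2 * \<alpha> i" if "i < M" for i
    using D(2)[OF rng[OF s(1) that]] lower[OF s(1) that] by (auto simp: \<alpha>_def)
  \<comment> \<open>A crude bound that only serves to replace \<alpha>^3 by (k h)^3: for \<alpha>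
    \<le> 1 the force 3 s h is at least (6 - 4/3) \<alpha>, hence at least 3 \<alpha>.\<close>
  have a1: "\<alpha> i \<le> k * h i" if i: "i < M" for i
  proof -
    have "\<alpha> i ^ 3 \<le> \<alpha> i" using power_decreasing[of 1 3 "\<alpha> i"] g(2,3)[OF i] by simp
    then have "\<alpha> i \<le> s * h i" using arc_force_ge[OF g(2)[OF i]] g(1,2)[OF i] by simp
    also have "\<dots> \<le> k * h i" using s h[OF i] by (intro mult_right_mono) auto
    finally show ?thesis .
  qed
  have a2: "2 * \<alpha> i \<le> s * h i + k ^ 3 * H\<^sup>2 * h i" if i: "i < M" for i
  proof -
    have "\<alpha> i ^ 3 \<le> (k * h i) ^ 3" using a1[OF i] g(2)[OF i] by (rule power_mono)
    also have "\<dots> = k ^ 3 * (h i)\<^sup>2 * h i" by (simp add: power_mult_distrib power2_eq_square power3_eq_cube)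
    also have "\<dots> \<le> k ^ 3 * H\<^sup>2 * h i" using h[OF i] k
      by (intro mult_right_mono mult_left_mono power_mono) auto
    finally have "\<alpha> i ^ 3 \<le> k ^ 3 * H\<^sup>2 * h i" .
    moreover have "\<alpha> i ^ 3 \<ge> 0" using g(2)[OF i] by simp
    ultimately show ?thesis using arc_force_ge[OF g(2)[OF i]] g(1)[OF i] by linarith
  qed
  \<comment> \<open>Because the total angle is exact, summing the local bounds shows that s falls
    short of k by at most k^3 H^2.\<close>
  have "k * L \<le> (\<Sum>i<M. s * h i + k ^ 3 * H\<^sup>2 * h i)"
    using s(2) unfolding \<Phi>_def \<alpha>_def[symmetric] by (metis (no_types, lifting) a2 lessThan_iff sum_mono)
  also have "\<dots> = (s + k ^ 3 * H\<^sup>2) * L"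
    by (simp add: L_def sum.distrib distrib_right flip: sum_distrib_left)
  finally have "k \<le> s + k ^ 3 * H\<^sup>2" using L by simp
  then have "k * h i \<le> s * h i + k ^ 3 * H\<^sup>2 * h i" if "i < M" for i
    using mult_right_mono[of k "s + k ^ 3 * H\<^sup>2" "h i"] h[OF that] by (simp add: distrib_right)
  moreover have "s * h i \<le> k * h i" if "i < M" for i using s h[OF that] by (intro mult_right_mono) auto
  ultimately have a3: "\<bar>2 * \<alpha> i - k * h i\<bar> \<le> k ^ 3 * H\<^sup>2 * h i" if "i < M" for i
    using a2[OF that] g(4)[OF that] that unfolding abs_le_iff by force
  show ?thesis
    using that[of \<alpha> s] g a1 a3 s(2) unfolding \<Phi>_def \<alpha>_def[symmetric] L_def by blast
qed

section \<open>Norm bounds and the geometry of circular arcs\<close>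

lemma norm_circ:
  assumes "norm e1 = 1" "norm e2 = 1" "e1 \<bullet> e2 = (0::real)"
  shows "norm (circ e1 e2 \<theta>) = 1"
proof -
  have "e1 \<bullet> e1 = 1" "e2 \<bullet> e2 = 1" using assms by (simp_all add: norm_eq_1)
  then have "circ e1 e2 \<theta> \<bullet> circ e1 e2 \<theta> = (cos \<theta>)\<^sup>2 + (sin \<theta>)\<^sup>2"
    using assms(3) by (simp add: circ_def inner_simps inner_commute power2_eq_square)
  then show ?thesis by (simp add: norm_eq_1)
qed

lemma norm_comb_le:
  fixes e1 e2 :: "'a::real_normed_vector"
  assumes "norm e1 \<le> m" "norm e2 \<le> m"
  shows "norm (s *\<^sub>R e1 + t *\<^sub>R e2) \<le> (\<bar>s\<bar> + \<bar>t\<bar>) * m"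
proof -
  have "norm (s *\<^sub>R e1 + t *\<^sub>R e2) \<le> \<bar>s\<bar> * norm e1 + \<bar>t\<bar> * norm e2"
    using norm_triangle_ineq[of "s *\<^sub>R e1" "t *\<^sub>R e2"] by simp
  also have "\<dots> \<le> \<bar>s\<bar> * m + \<bar>t\<bar> * m" using assms by (intro add_mono mult_left_mono) auto
  finally show ?thesis by (simp add: distrib_right)
qed

lemma norm_circ_tang_le:
  fixes e1 e2 :: "'a::real_normed_vector"
  assumes "norm e1 \<le> 1" "norm e2 \<le> 1"
  shows "norm (circ e1 e2 \<theta>) \<le> 2" "norm (tang e1 e2 \<theta>) \<le> 2"
proof -
  have "\<bar>cos \<theta>\<bar> \<le> 1" "\<bar>sin \<theta>\<bar> \<le> 1" by auto
  then show "norm (circ e1 e2 \<theta>) \<le> 2" "norm (tang e1 e2 \<theta>) \<le> 2"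
    using norm_comb_le[OF assms, of "cos \<theta>" "sin \<theta>"] norm_comb_le[OF assms(2,1), of "cos \<theta>" "- sin \<theta>"]
    unfolding circ_def tang_def scaleR_minus_left add_uminus_conv_diff abs_minus_cancel mult_1_right by linarith+
qed

lemma tang_lipschitz:
  fixes e1 e2 :: "'a::real_normed_vector"
  assumes "norm e1 \<le> 1" "norm e2 \<le> 1"
  shows "norm (tang e1 e2 \<theta> - tang e1 e2 \<phi>) \<le> 2 * \<bar>\<theta> - \<phi>\<bar>"
proof -
  have s: "\<bar>sin \<theta> - sin \<phi>\<bar> \<le> \<bar>\<theta> - \<phi>\<bar>"
  proof -
    have "\<bar>sin \<theta> - sin \<phi>\<bar> = 2 * \<bar>sin ((\<theta> - \<phi>) / 2)\<bar> * \<bar>cos ((\<theta> + \<phi>) / 2)\<bar>"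
      unfolding sin_diff_sin by (simp add: abs_mult)
    also have "\<dots> \<le> 2 * \<bar>(\<theta> - \<phi>) / 2\<bar> * 1"
      by (intro mult_mono abs_sin_x_le_abs_x) auto
    finally show ?thesis by simp
  qed
  have c: "\<bar>cos \<theta> - cos \<phi>\<bar> \<le> \<bar>\<theta> - \<phi>\<bar>"
  proof -
    have "\<bar>cos \<theta> - cos \<phi>\<bar> = 2 * \<bar>sin ((\<theta> + \<phi>) / 2)\<bar> * \<bar>sin ((\<phi> - \<theta>) / 2)\<bar>"
      unfolding cos_diff_cos by (simp add: abs_mult)
    also have "\<dots> \<le> 2 * 1 * \<bar>(\<phi> - \<theta>) / 2\<bar>"
      by (intro mult_mono abs_sin_x_le_abs_x) auto
    finally show ?thesis by simp
  qed
  have "tang e1 e2 \<theta> - tang e1 e2 \<phi> = (cos \<theta> - cos \<phi>) *\<^sub>R e2 + (- (sin \<theta> - sin \<phi>)) *\<^sub>R e1"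
    by (simp add: tang_def algebra_simps)
  also have "norm \<dots> \<le> (\<bar>cos \<theta> - cos \<phi>\<bar> + \<bar>- (sin \<theta> - sin \<phi>)\<bar>) * 1"
    by (rule norm_comb_le[OF assms(2,1)])
  also have "\<dots> \<le> 2 * \<bar>\<theta> - \<phi>\<bar>" using add_mono[OF c s] by (simp only: abs_minus_cancel mult_1_right mult_2)
  finally show ?thesis .
qed

text \<open>Symmetry about the mid-angle: the chord is purely tangential and the second difference
  purely radial there.\<close>

lemma circ_chords:
  "circ e1 e2 (\<phi> + \<alpha>) - circ e1 e2 (\<phi> - \<alpha>) = (2 * sin \<alpha>) *\<^sub>R tang e1 e2 \<phi>"
  "(1/2) *\<^sub>R (circ e1 e2 (\<phi> - \<alpha>) + circ e1 e2 (\<phi> + \<alpha>)) - circ e1 e2 \<phi> = (cos \<alpha> - 1) *\<^sub>R circ e1 e2 \<phi>"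
proof -
  have "circ e1 e2 (\<phi> - \<alpha>) = cos \<alpha> *\<^sub>R circ e1 e2 \<phi> - sin \<alpha> *\<^sub>R tang e1 e2 \<phi>"
    using circ_add[of e1 e2 \<phi> "- \<alpha>"] by simp
  note e = this circ_add[of e1 e2 \<phi> \<alpha>]
  show "circ e1 e2 (\<phi> + \<alpha>) - circ e1 e2 (\<phi> - \<alpha>) = (2 * sin \<alpha>) *\<^sub>R tang e1 e2 \<phi>"
    unfolding e by (simp flip: scaleR_add_left)
  show "(1/2) *\<^sub>R (circ e1 e2 (\<phi> - \<alpha>) + circ e1 e2 (\<phi> + \<alpha>)) - circ e1 e2 \<phi> = (cos \<alpha> - 1) *\<^sub>R circ e1 e2 \<phi>"
    unfolding e by (simp add: scaleR_half_double scaleR_left_diff_distrib flip: scaleR_add_left)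
qed

lemma dquad_circ:
  "dquad (circ e1 e2 (\<phi> - \<alpha>)) (circ e1 e2 \<phi>) (circ e1 e2 (\<phi> + \<alpha>)) t
     = sin \<alpha> *\<^sub>R tang e1 e2 \<phi> + (2 * t * (cos \<alpha> - 1)) *\<^sub>R circ e1 e2 \<phi>"
  unfolding dquad_def circ_chords by simp

text \<open>The comparison curve is the arc t -> \<open>circ e1 e2 (\<phi> + \<alpha> * t)\<close>.
  In the frame at \<phi> the terms of order \<alpha> cancel in the tangential coefficient s and the
  terms t \<alpha>^2 cancel in the radial coefficient c. Each remainder is at most \<alpha>^3, and
  the frame vectors have norm at most 2.\<close>

lemma dquad_circ_error:
  fixes e1 e2 :: "'a::real_normed_vector"
  assumes "norm e1 \<le> 1" "norm e2 \<le> 1" "0 \<le> \<alpha>" "\<alpha> \<le> 1" "\<bar>t\<bar> \<le> 1"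
  shows "norm (dquad (circ e1 e2 (\<phi> - \<alpha>)) (circ e1 e2 \<phi>) (circ e1 e2 (\<phi> + \<alpha>)) t - \<alpha> *\<^sub>R tang e1 e2 (\<phi> + \<alpha> * t)) \<le> 4 * \<alpha> ^ 3"
proof -
  have at: "\<bar>\<alpha> * t\<bar> \<le> \<alpha>" using assms by (simp add: abs_mult mult_left_le)
  have "\<bar>\<alpha> * t\<bar> ^ 3 \<le> \<alpha> ^ 3" "(\<alpha> * t)\<^sup>2 \<le> \<alpha>\<^sup>2"
    using at assms(3) by (auto intro: power_mono simp: abs_le_square_iff[symmetric])
  note at = at this
  define s c where "s = sin \<alpha> - \<alpha> * cos (\<alpha> * t)" and "c = \<alpha> * sin (\<alpha> * t) - 2 * t * (1 - cos \<alpha>)"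
  have "\<bar>s\<bar> \<le> \<alpha> ^ 3"
  proof -
    have "s = (sin \<alpha> - \<alpha>) + \<alpha> * (1 - cos (\<alpha> * t))" by (simp add: s_def algebra_simps)
    moreover have "\<bar>sin \<alpha> - \<alpha>\<bar> \<le> \<alpha> ^ 3 / 6" using abs_sin_diff_le[of \<alpha>] assms(3) by simp
    moreover have "\<alpha> * (1 - cos (\<alpha> * t)) \<le> \<alpha> * (\<alpha>\<^sup>2 / 2)"
      using one_minus_cos_le[of "\<alpha> * t"] at(3) assms(3) by (intro mult_left_mono) linarith+
    moreover have "0 \<le> \<alpha> * (1 - cos (\<alpha> * t))" using assms(3) by simp
    moreover have "\<alpha> * (\<alpha>\<^sup>2 / 2) = \<alpha> ^ 3 / 2" by (simp add: power2_eq_square power3_eq_cube)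
    moreover have "0 \<le> \<alpha> ^ 3" using assms(3) by simp
    ultimately show ?thesis unfolding abs_le_iff by linarith
  qed
  moreover have "\<bar>c\<bar> \<le> \<alpha> ^ 3"
  proof -
    have p4: "\<alpha> * \<alpha> ^ 3 \<le> \<alpha> ^ 3" using assms(3,4) by (simp add: mult_left_le_one_le)
    have "2 * (1 - cos \<alpha>) = 4 * (sin (\<alpha> / 2))\<^sup>2" using cos_double_sin[of "\<alpha> / 2"] by simp
    \<comment> \<open>A difference of squares, \<alpha>^2 - (2 sin(\<alpha>/2))^2, whose first
      factor is of third order.\<close>
    then have "\<alpha>\<^sup>2 - 2 * (1 - cos \<alpha>) = 2 * (\<alpha> / 2 - sin (\<alpha> / 2)) * (\<alpha> + 2 * sin (\<alpha> / 2))"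
      by (simp add: power2_eq_square algebra_simps)
    also have "\<bar>\<dots>\<bar> = 2 * \<bar>sin (\<alpha> / 2) - \<alpha> / 2\<bar> * \<bar>\<alpha> + 2 * sin (\<alpha> / 2)\<bar>"
      by (simp only: abs_mult abs_minus_commute[of "\<alpha> / 2"] abs_numeral)
    also have "\<dots> \<le> 2 * (\<bar>\<alpha> / 2\<bar> ^ 3 / 6) * (2 * \<alpha>)"
    proof (intro mult_mono abs_sin_diff_le)
      show "\<bar>\<alpha> + 2 * sin (\<alpha> / 2)\<bar> \<le> 2 * \<alpha>"
        using abs_sin_x_le_abs_x[of "\<alpha> / 2"] assms(3) by (simp add: abs_le_iff)
    qed auto
    also have "\<dots> = \<alpha> * \<alpha> ^ 3 / 12" using assms(3) by (simp add: power3_eq_cube)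
    finally have 1: "\<bar>\<alpha>\<^sup>2 - 2 * (1 - cos \<alpha>)\<bar> \<le> \<alpha> ^ 3 / 12" using p4 by linarith
    have "\<bar>t * (\<alpha>\<^sup>2 - 2 * (1 - cos \<alpha>))\<bar> \<le> \<alpha> ^ 3 / 12"
      using mult_mono[OF assms(5) 1] by (simp add: abs_mult)
    moreover have "\<bar>\<alpha> * (sin (\<alpha> * t) - \<alpha> * t)\<bar> \<le> \<alpha> * (\<alpha> ^ 3 / 6)"
    proof -
      have "\<bar>sin (\<alpha> * t) - \<alpha> * t\<bar> \<le> \<alpha> ^ 3 / 6" using abs_sin_diff_le[of "\<alpha> * t"] at(2) by linarith
      then show ?thesis unfolding abs_mult[of \<alpha>] using assms(3) by (intro mult_mono) auto
    qed
    moreover have "\<alpha> * (\<alpha> ^ 3 / 6) \<le> \<alpha> ^ 3 / 6" using p4 by simp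
    moreover have "c = \<alpha> * (sin (\<alpha> * t) - \<alpha> * t) + t * (\<alpha>\<^sup>2 - 2 * (1 - cos \<alpha>))"
      by (simp add: c_def algebra_simps power2_eq_square)
    moreover have "0 \<le> \<alpha> ^ 3" using assms(3) by simp
    ultimately show ?thesis by linarith
  qed
  moreover have "dquad (circ e1 e2 (\<phi> - \<alpha>)) (circ e1 e2 \<phi>) (circ e1 e2 (\<phi> + \<alpha>)) t - \<alpha> *\<^sub>R tang e1 e2 (\<phi> + \<alpha> * t)
      = s *\<^sub>R tang e1 e2 \<phi> + c *\<^sub>R circ e1 e2 \<phi>"
    unfolding dquad_circ tang_add s_def c_def by (simp add: algebra_simps)
  ultimately show ?thesis
    using norm_comb_le[OF norm_circ_tang_le(2)[OF assms(1,2)] norm_circ_tang_le(1)[OF assms(1,2)], of s \<phi> c \<phi>] by simp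
qed

text \<open>The first variation of the energy of an element, with each vertex force expressed in the
  frame of that vertex. The tangential coefficient is sin \<alpha> (2 cos \<alpha> + 8/3 (1 - cos
  \<alpha>)) / h = arc_force \<alpha> / (3 h) = s, with opposite signs at the two ends. The mid-node
  receives a purely radial force.\<close>

lemma circ_element:
  fixes e1 e2 W0 Wm W1 :: "'a::real_inner"
  assumes "h > 0" "arc_force \<alpha> = 3 * s * h"
  defines "P \<equiv> circ e1 e2" and "R \<equiv> tang e1 e2"
  shows "(1 / h) * ((P (\<phi> + \<alpha>) - P (\<phi> - \<alpha>)) \<bullet> (W1 - W0) +
       (16/3) * (((1/2) *\<^sub>R (P (\<phi> - \<alpha>) + P (\<phi> + \<alpha>)) - P \<phi>) \<bullet> ((1/2) *\<^sub>R (W0 + W1) - Wm)))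
    = s * (R (\<phi> + \<alpha>) \<bullet> W1 - R (\<phi> - \<alpha>) \<bullet> W0)
      + (2 * (sin \<alpha>)\<^sup>2 - 8/3 * (1 - cos \<alpha>) * cos \<alpha>) / h * (P (\<phi> + \<alpha>) \<bullet> W1 + P (\<phi> - \<alpha>) \<bullet> W0)
      + 16/3 * (1 - cos \<alpha>) / h * (P \<phi> \<bullet> Wm)"
proof -
  define p1 r1 p0 r0 m where "p1 = P (\<phi> + \<alpha>) \<bullet> W1" and "r1 = R (\<phi> + \<alpha>) \<bullet> W1"
    and "p0 = P (\<phi> - \<alpha>) \<bullet> W0" and "r0 = R (\<phi> - \<alpha>) \<bullet> W0" and "m = P \<phi> \<bullet> Wm"
  have 1: "P \<phi> \<bullet> W1 = cos \<alpha> * p1 - sin \<alpha> * r1" "R \<phi> \<bullet> W1 = cos \<alpha> * r1 + sin \<alpha> * p1"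
    using circ_add[of e1 e2 "\<phi> + \<alpha>" "- \<alpha>"] tang_add[of e1 e2 "\<phi> + \<alpha>" "- \<alpha>"]
    by (simp_all add: p1_def r1_def P_def R_def inner_simps)
  have 0: "P \<phi> \<bullet> W0 = cos \<alpha> * p0 + sin \<alpha> * r0" "R \<phi> \<bullet> W0 = cos \<alpha> * r0 - sin \<alpha> * p0"
    using circ_add[of e1 e2 "\<phi> - \<alpha>" "\<alpha>"] tang_add[of e1 e2 "\<phi> - \<alpha>" "\<alpha>"]
    by (simp_all add: p0_def r0_def P_def R_def inner_simps)
  have s: "s = 2 * sin \<alpha> * (4 - cos \<alpha>) / (3 * h)" using assms by (simp add: arc_force_def field_simps)
  have c1: "(P (\<phi> + \<alpha>) - P (\<phi> - \<alpha>)) \<bullet> (W1 - W0) = 2 * sin \<alpha> * (R \<phi> \<bullet> W1 - R \<phi> \<bullet> W0)"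
    unfolding P_def R_def circ_chords by (simp add: inner_simps right_diff_distrib)
  have c2: "((1/2) *\<^sub>R (P (\<phi> - \<alpha>) + P (\<phi> + \<alpha>)) - P \<phi>) \<bullet> ((1/2) *\<^sub>R (W0 + W1) - Wm)
     = (cos \<alpha> - 1) * ((P \<phi> \<bullet> W0 + P \<phi> \<bullet> W1) / 2 - m)"
    unfolding P_def circ_chords by (simp add: inner_simps m_def P_def add_divide_distrib right_diff_distrib distrib_left)
  show ?thesis
    unfolding c1 c2 0 1 s p1_def[symmetric] r1_def[symmetric] p0_def[symmetric] r0_def[symmetric] m_def[symmetric]
    using assms(1) by (simp add: field_simps power2_eq_square)
qed

section \<open>The discrete solution\<close>

text \<open>If the integrand fails to be integrable, its integral is 0 by convention, so pointwise
  bounds off a finite set suffice.\<close>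

lemma H2norm_le:
  fixes v :: "real \<Rightarrow> 'a::euclidean_space"
  assumes "a < b" "finite N" "B \<ge> 0"
    "\<And>y. y \<in> {a..b} - N \<Longrightarrow> norm (v y) \<le> B0 \<and> norm (dv {a..b} v y) \<le> B1 \<and> norm (dv {a..b} (dv {a..b} v) y) \<le> B2"
    "B0\<^sup>2 + B1\<^sup>2 + B2\<^sup>2 \<le> B"
  shows "H2norm a b v \<le> sqrt (B * (b - a))"
proof -
  let ?f = "\<lambda>x. (norm (v x))\<^sup>2 + (norm (dv {a..b} v x))\<^sup>2 + (norm (dv {a..b} (dv {a..b} v) x))\<^sup>2"
  have "integral {a..b} ?f \<le> B * (b - a)"
  proof (cases "?f integrable_on {a..b}")
    case True
    have "norm (?f y) \<le> B" if "y \<in> {a..b} - N" for y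
    proof -
      have "(norm (v y))\<^sup>2 \<le> B0\<^sup>2" "(norm (dv {a..b} v y))\<^sup>2 \<le> B1\<^sup>2" "(norm (dv {a..b} (dv {a..b} v) y))\<^sup>2 \<le> B2\<^sup>2"
        using assms(4)[OF that] by (auto intro!: power_mono)
      moreover have "norm (?f y) = ?f y" by simp
      ultimately show ?thesis using assms(5) by linarith
    qed
    then have "norm (integral {a..b} ?f) \<le> B * measure lborel (cbox a b)"
      using True assms(3) by (intro has_integral_bound_spike_finite[OF _ assms(2)]) (auto simp: has_integral_integral)
    then show ?thesis using assms(1) by simp
  next
    case False
    then show ?thesis using assms(1,3) by (simp add: not_integrable_integral)
  qed
  then show ?thesis unfolding H2norm_def by (rule real_sqrt_le_mono)
qed

text \<open>Regrouping by vertices: vertex j + 1 collects \<open>A j\<close> from the element on its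
  left and \<open>B (Suc j)\<close> from the one on its right, while the end vertices drop
  out.\<close>

lemma (in grid) node_sum_zero:
  fixes A B S :: "nat \<Rightarrow> real"
  assumes "S 0 = 0" "S M = 0" "\<And>j. Suc j < M \<Longrightarrow> A j + B (Suc j) = 0"
  shows "(\<Sum>i<M. A i * S (Suc i) + B i * S i) = 0"
proof -
  have "n < M \<Longrightarrow> (\<Sum>i<Suc n. A i * S (Suc i) + B i * S i) = A n * S (Suc n)" for n
  proof (induction n)
    case (Suc n)
    have "(\<Sum>i<Suc (Suc n). A i * S (Suc i) + B i * S i) = (A n + B (Suc n)) * S (Suc n) + A (Suc n) * S (Suc (Suc n))"
      using Suc by (simp add: distrib_right)
    then show ?case using assms(3)[OF Suc.prems] by simp
  qed (simp add: assms)
  from this[of "M - 1"] show ?thesis using M_pos assms(2) by simp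
qed

text \<open>\<open>ph\<close> is the derivative of the discrete solution: its nodal values lie on the great circle through
  \<open>e1\<close> and \<open>e2\<close>, the nodes of element \<open>i\<close> being separated by the angle \<open>al i\<close>. The balance condition on
  \<open>arc_force (al i)\<close> makes the tangential forces of neighbouring elements cancel.\<close>
locale circle_grid = grid +
  fixes k s H :: real and e1 e2 :: "'c::euclidean_space" and al :: "nat \<Rightarrow> real" and ph :: "real \<Rightarrow> 'c"
  assumes k: "k \<ge> 0" and e: "norm e1 = 1" "norm e2 \<le> 1" "e1 \<bullet> e2 = 0" "k = 0 \<or> norm e2 = 1"
    and balance: "\<And>i. i < M \<Longrightarrow> arc_force (al i) = 3 * s * h i"
    and al: "\<And>i. i < M \<Longrightarrow> 0 \<le> al i \<and> al i \<le> 1 \<and> al i \<le> k * h i"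
    and total: "(\<Sum>i<M. 2 * al i) = k * (b - a)"
    and al_error: "\<And>i. i < M \<Longrightarrow> \<bar>2 * al i - k * h i\<bar> \<le> k ^ 3 * H\<^sup>2 * h i"
    and h_le: "\<And>i. i < M \<Longrightarrow> h i \<le> H"
    and ph: "p2 ph" "\<And>i. i \<le> M \<Longrightarrow> ph (x i) = circ e1 e2 (\<Sum>j<i. 2 * al j)"
      "\<And>i. i < M \<Longrightarrow> ph (mid i) = circ e1 e2 ((\<Sum>j<i. 2 * al j) + al i)"
begin

text \<open>The angle of the mid-node; element i spans the angles \<open>mangle i - al i\<close> to
  \<open>mangle i + al i\<close>.\<close>

definition mangle :: "nat \<Rightarrow> real" where "mangle i = (\<Sum>j<i. 2 * al j) + al i"

lemma ph_nodes:
  assumes "i < M"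
  shows "ph (x i) = circ e1 e2 (mangle i - al i)" "ph (mid i) = circ e1 e2 (mangle i)"
    "ph (x (Suc i)) = circ e1 e2 (mangle i + al i)"
  using assms ph(2)[of i] ph(2)[of "Suc i"] ph(3)[of i] by (simp_all add: mangle_def add.commute)

lemma ph_ends: "ph a = circ e1 e2 0" "ph b = circ e1 e2 (k * (b - a))"
  using ph(2)[of 0] ph(2)[of M] x_0 x_M total by auto

lemma ph_unit:
  shows "i \<le> M \<Longrightarrow> norm (ph (x i)) = 1" "i < M \<Longrightarrow> norm (ph (mid i)) = 1"
proof -
  have *: "norm (circ e1 e2 \<theta>) = 1" if "k = 0 \<Longrightarrow> \<theta> = 0" for \<theta>
  proof (cases "k = 0")
    case True
    then show ?thesis using that e by simp
  next
    case False
    then have "norm e2 = 1" using e by auto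
    then show ?thesis using norm_circ[of e1 e2 \<theta>] e by auto
  qed
  have z: "al i = 0" if "k = 0" "i < M" for i using al[OF that(2)] that by simp
  show "i \<le> M \<Longrightarrow> norm (ph (x i)) = 1" "i < M \<Longrightarrow> norm (ph (mid i)) = 1"
    using ph(2)[of i] ph(3)[of i] z by (auto intro!: *)
qed

text \<open>Tangential contributions telescope because s is common to all elements; radial ones are
  cancelled node by node by the choice of \<open>lh\<close>.\<close>

lemma stationary:
  obtains lh :: "real \<Rightarrow> real" where "p2 lh" "lh a = 0" "lh b = 0"
    "\<And>g. p2 g \<Longrightarrow> g a = 0 \<Longrightarrow> g b = 0 \<Longrightarrow>
      integral {a..b} (\<lambda>y. dv {a..b} ph y \<bullet> dv {a..b} g y)
      + (\<Sum>i<M. h i / 6 * (lh (x i) * (ph (x i) \<bullet> g (x i)) + 4 * (lh (mid i) * (ph (mid i) \<bullet> g (mid i)))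
                 + lh (x (Suc i)) * (ph (x (Suc i)) \<bullet> g (x (Suc i))))) = 0"
proof -
  \<comment> \<open>The radial force of element i on each of its two end vertices, from
    \<open>circ_element\<close>.\<close>
  define N where "N i = (2 * (sin (al i))\<^sup>2 - 8/3 * (1 - cos (al i)) * cos (al i)) / h i" for i
  \<comment> \<open>Minus the total radial force at an interior vertex over its quadrature weight
    (h(j-1) + h(j))/6. The end values are 0 as the multiplier space demands; no force has to be
    cancelled there because g vanishes.\<close>
  define V where "V j = (if 0 < j \<and> j < M then - (N (j - 1) + N j) * 6 / (h (j - 1) + h j) else 0)" for j
  \<comment> \<open>Minus the mid-node force 16/3 (1 - cos) / h over the weight 4 h / 6.\<close>
  define Q where "Q i = - 8 * (1 - cos (al i)) / (h i)\<^sup>2" for i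
  obtain lh :: "real \<Rightarrow> real" where lh: "p2 lh" "\<And>i. i \<le> M \<Longrightarrow> lh (x i) = V i" "\<And>i. i < M \<Longrightarrow> lh (mid i) = Q i"
    by (rule p2_exists[of V Q]) blast
  show ?thesis
  proof (rule that[OF lh(1)])
    show "lh a = 0" "lh b = 0" using lh(2)[of 0] lh(2)[of M] x_0 x_M by (simp_all add: V_def)
    fix g :: "real \<Rightarrow> 'c" assume g: "p2 g" "g a = 0" "g b = 0"
    define r S where "r i = tang e1 e2 (\<Sum>j<i. 2 * al j) \<bullet> g (x i)" and "S i = ph (x i) \<bullet> g (x i)" for i
    define A B where "A i = N i + h i / 6 * V (Suc i)" and "B i = N i + h i / 6 * V i" for i
    define E where "E i = (1 / h i) * ((ph (x (Suc i)) - ph (x i)) \<bullet> (g (x (Suc i)) - g (x i))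
        + (16/3) * (((1/2) *\<^sub>R (ph (x i) + ph (x (Suc i))) - ph (mid i)) \<bullet> ((1/2) *\<^sub>R (g (x i) + g (x (Suc i))) - g (mid i))))" for i
    define F where "F i = h i / 6 * (lh (x i) * (ph (x i) \<bullet> g (x i)) + 4 * (lh (mid i) * (ph (mid i) \<bullet> g (mid i)))
                 + lh (x (Suc i)) * (ph (x (Suc i)) \<bullet> g (x (Suc i))))" for i
    have E: "integral {a..b} (\<lambda>y. dv {a..b} ph y \<bullet> dv {a..b} g y) = (\<Sum>i<M. E i)"
      using has_integral_elements[OF p2_dv_inner[OF ph(1) g(1)]] unfolding E_def by (rule integral_unique)
    have EF: "E i + F i = s * (r (Suc i) - r i) + (A i * S (Suc i) + B i * S i)" if i: "i < M" for i
    proof -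
      have "E i = s * (r (Suc i) - r i) + N i * (S (Suc i) + S i) + 16/3 * (1 - cos (al i)) / h i * (ph (mid i) \<bullet> g (mid i))"
      proof -
        have "tang e1 e2 (mangle i - al i) \<bullet> g (x i) = r i" "tang e1 e2 (mangle i + al i) \<bullet> g (x (Suc i)) = r (Suc i)"
          by (simp_all add: r_def mangle_def add.commute)
        then show ?thesis
          using circ_element[OF _ balance[OF i], of e1 e2 "mangle i" "g (x (Suc i))" "g (x i)" "g (mid i)"] step[OF i]
          unfolding E_def S_def N_def ph_nodes[OF i] by simp
      qed
      moreover have "F i = h i / 6 * V i * S i - 16/3 * (1 - cos (al i)) / h i * (ph (mid i) \<bullet> g (mid i)) + h i / 6 * V (Suc i) * S (Suc i)"
      proof -
        have Qe: "h i / 6 * (4 * (Q i * w)) = - (16/3 * (1 - cos (al i)) / h i * w)" for w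
        proof -
          have "\<eta> / 6 * (4 * (- 8 * c / \<eta>\<^sup>2 * w)) = - (16/3 * c / \<eta> * w)" if "\<eta> > 0" for \<eta> c :: real
            using that by (simp add: power2_eq_square field_simps)
          then show ?thesis using step[OF i] by (simp only: Q_def diff_gt_0_iff_gt)
        qed
        have e: "lh (x i) = V i" "lh (x (Suc i)) = V (Suc i)" "lh (mid i) = Q i"
          using i lh(2)[of i] lh(2)[of "Suc i"] lh(3)[of i] by simp_all
        show ?thesis unfolding F_def S_def e distrib_left Qe mult.assoc[of "h i / 6"] by linarith
      qed
      ultimately show ?thesis by (simp add: A_def B_def algebra_simps)
    qed
    have "(\<Sum>i<M. E i) + (\<Sum>i<M. F i) = s * (\<Sum>i<M. r (Suc i) - r i) + (\<Sum>i<M. A i * S (Suc i) + B i * S i)"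
      using EF by (simp add: sum.distrib[symmetric] sum_distrib_left)
    also have "(\<Sum>i<M. r (Suc i) - r i) = 0"
      unfolding sum_lessThan_telescope using g x_0 x_M by (simp add: r_def)
    also have "(\<Sum>i<M. A i * S (Suc i) + B i * S i) = 0"
    proof (rule node_sum_zero)
      show "S 0 = 0" "S M = 0" using g x_0 x_M by (simp_all add: S_def)
      fix j assume j: "Suc j < M"
      then have pos: "h j + h (Suc j) > 0" using step[of j] step[of "Suc j"] by simp
      have cancel: "n + d / 6 * (- n * 6 / d) = 0" if "d > 0" for n d :: real using that by simp
      have "A j + B (Suc j) = N j + N (Suc j) + (h j + h (Suc j)) / 6 * V (Suc j)"
        unfolding A_def B_def by (simp add: field_simps)
      moreover have "V (Suc j) = - (N j + N (Suc j)) * 6 / (h j + h (Suc j))" using j by (simp add: V_def)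
      ultimately show "A j + B (Suc j) = 0" using cancel[OF pos] by (simp only:)
    qed
    finally show "integral {a..b} (\<lambda>y. dv {a..b} ph y \<bullet> dv {a..b} g y)
      + (\<Sum>i<M. h i / 6 * (lh (x i) * (ph (x i) \<bullet> g (x i)) + 4 * (lh (mid i) * (ph (mid i) \<bullet> g (mid i)))
                 + lh (x (Suc i)) * (ph (x (Suc i)) \<bullet> g (x (Suc i))))) = 0"
      unfolding E F_def by simp
  qed
qed

section \<open>Error estimates for the discrete tangent and its antiderivative\<close>

definition err_bound :: real where "err_bound = (10 * k ^ 3 + 4 * k ^ 4 * (b - a)) * H\<^sup>2"

lemma err_bound_nonneg: "0 \<le> err_bound"
  using k ab by (auto simp: err_bound_def intro!: mult_nonneg_nonneg add_nonneg_nonneg)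

text \<open>The phase error is the accumulated error of the preceding elements plus the fraction (1
  + t)/2 of the current one. Local errors carry the weight h, so their sum is controlled by b - a
  whatever the number of elements.\<close>

lemma mangle_error:
  assumes i: "i < M" and t: "\<bar>t\<bar> \<le> 1" and y: "y - x i = (1 + t) * h i / 2"
  shows "\<bar>mangle i + al i * t - k * (y - a)\<bar> \<le> 2 * k ^ 3 * H\<^sup>2 * (b - a)"
proof -
  have "(\<Sum>j<i. 2 * al j) - k * (x i - a) = (\<Sum>j<i. 2 * al j - k * h j)"
    using i sum_h[of i] by (simp add: sum_subtractf sum_distrib_left[symmetric] del: sum_subtractf_nat)
  also have "\<bar>\<dots>\<bar> \<le> (\<Sum>j<i. k ^ 3 * H\<^sup>2 * h j)"
    using al_error i by (intro order_trans[OF sum_abs] sum_mono) auto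
  also have "\<dots> = k ^ 3 * H\<^sup>2 * (x i - a)"
    using i sum_h[of i] by (simp add: sum_distrib_left[symmetric])
  also have "\<dots> \<le> k ^ 3 * H\<^sup>2 * (b - a)" using k x_in[of i] i by (intro mult_left_mono) auto
  finally have 1: "\<bar>(\<Sum>j<i. 2 * al j) - k * (x i - a)\<bar> \<le> k ^ 3 * H\<^sup>2 * (b - a)" .
  have "\<bar>(1 + t) / 2 * (2 * al i - k * h i)\<bar> \<le> 1 * (k ^ 3 * H\<^sup>2 * h i)"
    unfolding abs_mult using t al_error[OF i] by (intro mult_mono) auto
  also have "\<dots> \<le> k ^ 3 * H\<^sup>2 * (b - a)" using k x_in[of i] x_in[of "Suc i"] i
    by (simp, intro mult_left_mono) auto
  finally have 2: "\<bar>(1 + t) / 2 * (2 * al i - k * h i)\<bar> \<le> k ^ 3 * H\<^sup>2 * (b - a)" .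
  have "y - a = (x i - a) + (1 + t) * h i / 2" using y by linarith
  then have "mangle i + al i * t - k * (y - a) = ((\<Sum>j<i. 2 * al j) - k * (x i - a)) + (1 + t) / 2 * (2 * al i - k * h i)"
    by (simp only: mangle_def) (simp add: field_simps)
  then show ?thesis using 1 2 by linarith
qed

text \<open>Three sources make up \<open>err_bound\<close>: replacing the arc by a quadratic gives 8
  k^3 (2/h times 4 (k h)^3), the wrong angular speed 2 al / h gives 2 k^3 (frame norm 2), and the
  phase error gives 4 k^4 (b - a) (Lipschitz constant 2 times the factor 2 of
  \<open>mangle_error\<close>, times k).\<close>

lemma dv_ph_error:
  assumes y: "y \<in> {a..b}" "y \<notin> vertices"
  shows "norm (dv {a..b} ph y - k *\<^sub>R tang e1 e2 (k * (y - a))) \<le> err_bound"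
proof -
  obtain i where i: "i < M" "y \<in> {x i<..<x (Suc i)}" using open_elem_cases[OF y] .
  define t where "t = ref i y"
  have h: "h i > 0" "h i \<le> H" using step[OF i(1)] h_le[OF i(1)] by auto
  have t: "\<bar>t\<bar> \<le> 1" unfolding t_def using i by (intro abs_refc_le step) auto
  have yt: "y - x i = (1 + t) * h i / 2" using h(1) by (simp add: t_def refc_def field_simps)
  note al = al[OF i(1)]
  let ?R = "tang e1 e2" and ?\<psi> = "mangle i + al i * t"
  have n: "norm e1 \<le> 1" "norm e2 \<le> 1" using e by auto
  let ?D = "dquad (ph (x i)) (ph (mid i)) (ph (x (Suc i))) t"
  have "dv {a..b} ph y = (2 / h i) *\<^sub>R ?D" unfolding t_def by (rule p2_dv[OF ph(1) i])
  then have "dv {a..b} ph y - k *\<^sub>R ?R (k * (y - a)) = (2 / h i) *\<^sub>R (?D - al i *\<^sub>R ?R ?\<psi>)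
      + (2 / h i * al i - k) *\<^sub>R ?R ?\<psi> + k *\<^sub>R (?R ?\<psi> - ?R (k * (y - a)))"
    by (simp add: algebra_simps)
  also have "norm \<dots> \<le> 8 * k ^ 3 * H\<^sup>2 + 2 * k ^ 3 * H\<^sup>2 + 4 * k ^ 4 * H\<^sup>2 * (b - a)"
  proof (intro norm_triangle_le add_mono)
    have "norm (?D - al i *\<^sub>R ?R ?\<psi>) \<le> 4 * al i ^ 3"
      unfolding ph_nodes[OF i(1)] using al t by (intro dquad_circ_error n) auto
    also have "\<dots> \<le> 4 * (k * h i) ^ 3" using al by (intro mult_left_mono power_mono) auto
    finally have "norm ((2 / h i) *\<^sub>R (?D - al i *\<^sub>R ?R ?\<psi>)) \<le> 2 / h i * (4 * (k * h i) ^ 3)"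
      using h by (simp del: times_divide_eq_left add: mult_left_mono)
    also have "\<dots> = 8 * k ^ 3 * (h i)\<^sup>2" using h by (simp add: power2_eq_square power3_eq_cube)
    also have "\<dots> \<le> 8 * k ^ 3 * H\<^sup>2" using h k by (intro mult_left_mono power_mono) auto
    finally show "norm ((2 / h i) *\<^sub>R (?D - al i *\<^sub>R ?R ?\<psi>)) \<le> 8 * k ^ 3 * H\<^sup>2" .
    have "2 / \<eta> * c - k = (2 * c - k * \<eta>) / \<eta>" if "\<eta> > 0" for \<eta> c
      using that by (simp add: diff_divide_distrib)
    from this[OF h(1)] have "\<bar>2 / h i * al i - k\<bar> = \<bar>2 * al i - k * h i\<bar> / h i"
      using h(1) by (simp only: abs_divide abs_of_pos)
    also have "\<dots> \<le> k ^ 3 * H\<^sup>2" using al_error[OF i(1)] h(1) by (simp only: pos_divide_le_eq)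
    finally have "\<bar>2 / h i * al i - k\<bar> * norm (?R ?\<psi>) \<le> k ^ 3 * H\<^sup>2 * 2"
      using norm_circ_tang_le(2)[OF n] by (intro mult_mono) auto
    then show "norm ((2 / h i * al i - k) *\<^sub>R ?R ?\<psi>) \<le> 2 * k ^ 3 * H\<^sup>2" by simp
    have "norm (?R ?\<psi> - ?R (k * (y - a))) \<le> 2 * (2 * k ^ 3 * H\<^sup>2 * (b - a))"
      by (rule order_trans[OF tang_lipschitz[OF n] mult_left_mono[OF mangle_error[OF i(1) t yt]]]) simp
    then have "k * norm (?R ?\<psi> - ?R (k * (y - a))) \<le> k * (2 * (2 * k ^ 3 * H\<^sup>2 * (b - a)))"
      using k by (rule mult_left_mono)
    then show "norm (k *\<^sub>R (?R ?\<psi> - ?R (k * (y - a)))) \<le> 4 * k ^ 4 * H\<^sup>2 * (b - a)"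
      using k unfolding norm_scaleR abs_of_nonneg[OF k] by (simp add: eval_nat_numeral mult_ac)
  qed
  also have "\<dots> = err_bound" by (simp add: err_bound_def algebra_simps)
  finally show ?thesis .
qed

lemma ph_error:
  assumes y: "y \<in> {a..b}"
  shows "norm (ph y - circ e1 e2 (k * (y - a))) \<le> err_bound * (b - a)"
proof -
  have 1: "(dv {a..b} ph has_integral ph y - ph a) {a..y}" using y by (intro p2_ftc[OF ph(1)]) auto
  have 2: "((\<lambda>y. k *\<^sub>R tang e1 e2 (k * (y - a))) has_integral circ e1 e2 (k * (y - a)) - circ e1 e2 (k * (a - a))) {a..y}"
    using y by (intro fundamental_theorem_of_calculus circ_deriv) auto
  have "norm ((ph y - ph a) - (circ e1 e2 (k * (y - a)) - circ e1 e2 (k * (a - a)))) \<le> err_bound * measure lborel (cbox a y)"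
  proof (rule has_integral_bound_spike_finite[OF err_bound_nonneg finite_vertices])
    show "((\<lambda>y. dv {a..b} ph y - k *\<^sub>R tang e1 e2 (k * (y - a))) has_integral
       (ph y - ph a) - (circ e1 e2 (k * (y - a)) - circ e1 e2 (k * (a - a)))) (cbox a y)"
      using has_integral_diff[OF 1 2] by simp
  qed (use y dv_ph_error in auto)
  moreover have "err_bound * measure lborel (cbox a y) \<le> err_bound * (b - a)" using y err_bound_nonneg by (intro mult_left_mono) auto
  ultimately show ?thesis using ph_ends by simp
qed

text \<open>Each integration from a, where both functions agree, costs a factor b - a; this explains
  the powers 0, 2 and 4 under the root.\<close>

lemma antiderivative_error:
  assumes u: "\<And>y. y \<in> {a..b} \<Longrightarrow> (u has_vector_derivative circ e1 e2 (k * (y - a))) (at y within {a..b})"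
    and v: "\<And>y. y \<in> {a..b} \<Longrightarrow> (v has_vector_derivative ph y) (at y within {a..b})"
    and "u a = v a"
  shows "H2norm a b (\<lambda>y. u y - v y) \<le> sqrt ((b - a) * ((b - a) ^ 4 + (b - a)\<^sup>2 + 1)) * err_bound"
proof -
  let ?p = "\<lambda>y. circ e1 e2 (k * (y - a))" and ?d = "dv {a..b}" and ?L = "b - a"
  have d: "((\<lambda>y. u y - v y) has_vector_derivative ?p y - ph y) (at y within {a..b})" if "y \<in> {a..b}" for y
    using u[OF that] v[OF that] by (rule has_vector_derivative_diff)
  have d1: "?d (\<lambda>y. u y - v y) y = ?p y - ph y" if "y \<in> {a..b}" for y using dv_eqI[OF ab that d[OF that]] .
  have d2: "?d (?d (\<lambda>y. u y - v y)) y = k *\<^sub>R tang e1 e2 (k * (y - a)) - ?d ph y" if "y \<in> {a..b} - vertices" for y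
  proof -
    have y: "y \<in> {a..b}" "y \<notin> vertices" using that by auto
    have "?d (?d (\<lambda>y. u y - v y)) y = ?d (\<lambda>y. ?p y - ph y) y" by (rule dv_cong[OF d1 y(1)])
    also have "\<dots> = k *\<^sub>R tang e1 e2 (k * (y - a)) - ?d ph y"
      by (intro dv_eqI[OF ab y(1)] has_vector_derivative_diff circ_deriv p2_has_deriv_dv[OF ph(1) y])
    finally show ?thesis .
  qed
  have b1: "norm (?p y - ph y) \<le> err_bound * ?L" if "y \<in> {a..b}" for y
    using ph_error[OF that] by (simp add: norm_minus_commute)
  have b0: "norm (u y - v y) \<le> err_bound * ?L * ?L" if y: "y \<in> {a..b}" for y
  proof -
    have "((\<lambda>y. ?p y - ph y) has_integral (u y - v y) - (u a - v a)) {a..y}"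
      using y by (intro fundamental_theorem_of_calculus)
       (auto intro!: has_vector_derivative_within_subset[OF d, of _ "{a..y}"])
    then have "norm ((u y - v y) - (u a - v a)) \<le> err_bound * ?L * measure lborel (cbox a y)"
      using y b1 ab err_bound_nonneg by (intro has_integral_bound) auto
    also have "\<dots> \<le> err_bound * ?L * ?L" using y err_bound_nonneg ab by (intro mult_left_mono) auto
    finally show ?thesis using assms(3) by simp
  qed
  have "H2norm a b (\<lambda>y. u y - v y) \<le> sqrt ((((b - a) ^ 4 + (b - a)\<^sup>2 + 1) * err_bound\<^sup>2) * (b - a))"
  proof (rule H2norm_le[OF ab finite_vertices])
    show "0 \<le> ((b - a) ^ 4 + (b - a)\<^sup>2 + 1) * err_bound\<^sup>2" by simp
    show "norm (u y - v y) \<le> err_bound * ?L * ?L \<and> norm (?d (\<lambda>y. u y - v y) y) \<le> err_bound * ?L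
      \<and> norm (?d (?d (\<lambda>y. u y - v y)) y) \<le> err_bound" if "y \<in> {a..b} - vertices" for y
      using b0[of y] b1[of y] d1[of y] d2[OF that] dv_ph_error[of y] that by (simp add: norm_minus_commute)
    show "(err_bound * ?L * ?L)\<^sup>2 + (err_bound * ?L)\<^sup>2 + err_bound\<^sup>2 \<le> ((b - a) ^ 4 + (b - a)\<^sup>2 + 1) * err_bound\<^sup>2"
      by (simp add: power_mult_distrib distrib_left distrib_right eval_nat_numeral mult_ac)
  qed
  also have "\<dots> = sqrt ((b - a) * ((b - a) ^ 4 + (b - a)\<^sup>2 + 1) * err_bound\<^sup>2)" by (simp add: mult_ac)
  also have "\<dots> = sqrt ((b - a) * ((b - a) ^ 4 + (b - a)\<^sup>2 + 1)) * err_bound"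
    using err_bound_nonneg by (simp add: real_sqrt_mult)
  finally show ?thesis .
qed

end

theorem mainTheorem10:
  fixes a b cq :: real and uD u :: "real \<Rightarrow> real^'d" and lam :: "real \<Rightarrow> real"
  assumes "a < b" and "cq > 0"
    and "uD \<in> sobH 4 a b" and "u \<in> sobH 4 a b"
    and "(\<lambda>y. u y - uD y) \<in> H2D a b"
    and "lam \<in> sobH 2 a b"
    and "\<forall>y\<in>{a<..<b}. (norm (dv {a..b} u y))\<^sup>2 = 1"
    and "\<forall>v\<in>H2D a b. integral {a..b} (\<lambda>y. dv {a..b} (dv {a..b} u) y \<bullet> dv {a..b} (dv {a..b} v) y
                                       + lam y * (dv {a..b} u y \<bullet> dv {a..b} v y)) = 0"
    and "\<exists>\<alpha>>0. \<forall>v\<in>kerB a b u. a_form a b lam v v \<ge> \<alpha> * (H2norm a b v)\<^sup>2"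
  shows "\<exists>h0>0. \<exists>c>0. \<forall>(M::nat) (x::nat \<Rightarrow> real).
           mesh a b M x \<and> quasi_uniform cq M x \<and> meshsize M x \<le> h0 \<longrightarrow>
           (\<exists>(uh::real \<Rightarrow> real^'d) (lh::real \<Rightarrow> real).
              (\<lambda>y. uh y - herm3 a b M x uD y) \<in> S31D a b M x
            \<and> lh \<in> S20_0 a b M x
            \<and> (\<forall>v\<in>S31D a b M x. \<forall>mu\<in>S20_0 a b M x. Fh a b M x uh lh v mu = 0)
            \<and> H2norm a b (\<lambda>y. u y - uh y) \<le> c * (meshsize M x)\<^sup>2)"
proof -
  let ?d = "dv {a..b}"
  note ab = assms(1)
  have u1: "(u has_vector_derivative ?d u y) (at y within {a..b})"
    and u2: "(?d u has_vector_derivative ?d (?d u) y) (at y within {a..b})"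
    and uD1: "(uD has_vector_derivative ?d uD y) (at y within {a..b})" if "y \<in> {a..b}" for y
    using sobH_has_vector_derivative[OF ab assms(4) _ that, of 0] sobH_has_vector_derivative[OF ab assms(4) _ that, of 1]
      sobH_has_vector_derivative[OF ab assms(3) _ that, of 0] by simp_all
  have uc: "continuous_on {a..b} (?d u)" "continuous_on {a..b} (?d (?d u))" "continuous_on {a..b} lam"
    using sobH_continuous_on[OF ab assms(4), of 1] sobH_continuous_on[OF ab assms(4), of 2] sobH_continuous_on[OF ab assms(6), of 0]
    by (simp_all add: numeral_2_eq_2)
  have u3: "(?d (?d u) has_vector_derivative lam y *\<^sub>R ?d u y) (at y within {a..b})" if "y \<in> {a..b}" for y
    by (rule euler_lagrange[OF ab uc _ that]) (use assms(8) in blast)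
  have unit: "norm (?d u y) = 1" if "y \<in> {a<..<b}" for y
    by (rule power2_eq_imp_eq) (use assms(7) that in auto)
  obtain k e1 e2 where k: "k \<ge> 0" and e: "norm e1 = 1" "norm e2 \<le> 1" "e1 \<bullet> e2 = 0" "k = 0 \<or> norm e2 = 1"
    and p: "\<And>y. y \<in> {a..b} \<Longrightarrow> ?d u y = circ e1 e2 (k * (y - a))"
    by (rule great_circle[OF ab u2 u3 unit]) (assumption | rule that)+
  have bc: "u a = uD a" "?d u a = ?d uD a" "?d u b = ?d uD b"
  proof -
    have "?d (\<lambda>y. u y - uD y) y = ?d u y - ?d uD y" if "y \<in> {a..b}" for y
      by (rule dv_eqI[OF ab that has_vector_derivative_diff[OF u1[OF that] uD1[OF that]]])
    from this[of a] this[of b] show "u a = uD a" "?d u a = ?d uD a" "?d u b = ?d uD b"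
      using assms(5) ab by (auto simp: H2D_def)
  qed
  define L K C where "L = b - a" and "K = 10 * k ^ 3 + 4 * k ^ 4 * (b - a)"
    and "C = sqrt ((b - a) * ((b - a) ^ 4 + (b - a)\<^sup>2 + 1))"
  have CK: "0 \<le> C * K" unfolding C_def K_def using ab k by simp
  show ?thesis
  \<comment> \<open>The threshold 1 / (k + 1) ensures k h \<le> 1, as
    \<open>equilibrium_angles\<close> requires, and makes sense for k = 0. The summand 1 in the
    constant keeps it positive when K = 0.\<close>
  proof (rule exI[of _ "1 / (k + 1)"], rule conjI[OF _ exI[of _ "C * K + 1"]], goal_cases)
    case 1
    show ?case using k by simp
  next
    case 2
    show ?case
    proof (rule conjI[OF _ allI[OF allI[OF impI]]])
      show "0 < C * K + 1" using CK by simp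
      fix M and x :: "nat \<Rightarrow> real"
      assume mesh: "mesh a b M x \<and> quasi_uniform cq M x \<and> meshsize M x \<le> 1 / (k + 1)"
      interpret grid a b M x using mesh by unfold_locales simp
      define H where "H = meshsize M x"
      have h: "0 < h i \<and> h i \<le> H" if "i < M" for i
        using step[OF that] meshsize_ge[OF that] by (simp add: H_def)
      have "k * H \<le> k * (1 / (k + 1))" using mesh k unfolding H_def by (intro mult_left_mono) auto
      also have "\<dots> \<le> 1" using k by simp
      finally have kH: "k * H \<le> 1" .
      obtain s al where al: "\<And>i. i < M \<Longrightarrow> arc_force (al i) = 3 * s * h i"
        "\<And>i. i < M \<Longrightarrow> 0 \<le> al i \<and> al i \<le> 1 \<and> al i \<le> k * h i"
        "(\<Sum>i<M. 2 * al i) = k * (\<Sum>i<M. h i)"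
        "\<And>i. i < M \<Longrightarrow> \<bar>2 * al i - k * h i\<bar> \<le> k ^ 3 * H\<^sup>2 * h i"
        by (rule equilibrium_angles[where h = h, OF k h M_pos kH]) (assumption | rule that)+
      obtain ph where ph: "p2 ph" "\<And>i. i \<le> M \<Longrightarrow> ph (x i) = circ e1 e2 (\<Sum>j<i. 2 * al j)"
        "\<And>i. i < M \<Longrightarrow> ph (mid i) = circ e1 e2 ((\<Sum>j<i. 2 * al j) + al i)"
        by (rule p2_exists[of "\<lambda>i. circ e1 e2 (\<Sum>j<i. 2 * al j)" "\<lambda>i. circ e1 e2 ((\<Sum>j<i. 2 * al j) + al i)"]) blast
      have tot: "(\<Sum>i<M. 2 * al i) = k * (b - a)" using al(3) sum_h[of M] x_M by simp
      interpret circle_grid a b M x k s H e1 e2 al ph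
        by unfold_locales (use k e al tot ph h in blast)+
      obtain lh :: "real \<Rightarrow> real" where lh: "p2 lh" "lh a = 0" "lh b = 0"
        and lh_eq: "\<And>g. p2 g \<Longrightarrow> g a = 0 \<Longrightarrow> g b = 0 \<Longrightarrow>
      integral {a..b} (\<lambda>y. ?d ph y \<bullet> ?d g y)
      + (\<Sum>i<M. h i / 6 * (lh (x i) * (ph (x i) \<bullet> g (x i)) + 4 * (lh (mid i) * (ph (mid i) \<bullet> g (mid i)))
                 + lh (x (Suc i)) * (ph (x (Suc i)) \<bullet> g (x (Suc i))))) = 0"
        by (rule stationary) blast
      \<comment> \<open>The initial value \<open>u a = uD a\<close> matches the Hermite interpolant
        at a; at b only the derivative is prescribed.\<close>
      define uh where "uh y = u a + integral {a..y} ph" for y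
      note uh = p2_antiderivative[OF ph(1), where c = "u a", folded uh_def]
      let ?X = "\<lambda>y. uh y - herm3 a b M x uD y"
      have X: "?X \<in> S31D a b M x"
      proof -
        note hm = herm3_eq[where f = uD]
        have "?X \<in> spline 3 1 a b M x" "?d ?X a = ph a - ?d (herm3 a b M x uD) a" "?d ?X b = ph b - ?d (herm3 a b M x uD) b"
          using spline31_diff[OF uh(4) hm(1)] uh(3) ab by auto
        moreover have "ph a = ?d (herm3 a b M x uD) a" "ph b = ?d (herm3 a b M x uD) b" "?X a = 0"
          using hm(2)[of 0] hm(3)[of 0] hm(3)[of M] x_0 x_M ph_ends p[of a] p[of b] bc ab uh(1) by simp_all
        ultimately show ?thesis unfolding S31D_def by (simp add: spline31_H2D)
      qed
      have lhS: "lh \<in> S20_0 a b M x"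
        using p2_spline2[OF lh(1)] p2_sobH1(3)[OF lh(1)] lh by (simp add: S20_0_def H10_def)
      have F: "Fh a b M x uh lh v mu = 0" if v: "v \<in> S31D a b M x" and "mu \<in> S20_0 a b M x" for v mu
      proof -
        have v': "v \<in> spline 3 1 a b M x" "?d v a = 0" "?d v b = 0" using v by (auto simp: S31D_def H2D_def)
        have dd: "?d (?d uh) y = ?d ph y" if "y \<in> {a..b}" for y by (rule dv_cong[OF uh(3) that])
        have "integral {a..b} (\<lambda>y. ?d (?d uh) y \<bullet> ?d (?d v) y) = integral {a..b} (\<lambda>y. ?d ph y \<bullet> ?d (?d v) y)"
          by (rule integral_cong) (simp add: dd)
        moreover have nodes: "?d uh (x i) = ph (x i)" "?d uh (x (Suc i)) = ph (x (Suc i))" "?d uh (mid i) = ph (mid i)" if "i < M" for i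
          using uh(3)[OF x_in[of i]] uh(3)[OF x_in[of "Suc i"]] uh(3)[OF subsetD[OF elem_sub[OF that] mid_in[OF that]]] that by simp_all
        then have "ip2 a b M x lh (\<lambda>y. ?d uh y \<bullet> ?d v y) =
            (\<Sum>i<M. h i / 6 * (lh (x i) * (ph (x i) \<bullet> ?d v (x i)) + 4 * (lh (mid i) * (ph (mid i) \<bullet> ?d v (mid i)))
                 + lh (x (Suc i)) * (ph (x (Suc i)) \<bullet> ?d v (x (Suc i)))))"
          unfolding ip2_def interp2_integral by (intro sum.cong) auto
        moreover have "ip2 a b M x mu (\<lambda>y. (norm (?d uh y))\<^sup>2 - 1) = 0"
          unfolding ip2_def interp2_integral
          by (intro sum.neutral ballI) (use nodes ph_unit in auto)
        ultimately show ?thesis using lh_eq[OF spline31_p2[OF v'(1)] v'(2,3)] unfolding Fh_def by simp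
      qed
      have uP: "(u has_vector_derivative circ e1 e2 (k * (y - a))) (at y within {a..b})" if "y \<in> {a..b}" for y
        using u1[OF that] p[OF that] by simp
      have "H2norm a b (\<lambda>y. u y - uh y) \<le> C * err_bound"
        unfolding C_def by (rule antiderivative_error[OF uP uh(2) uh(1)[symmetric]])
      also have "\<dots> \<le> (C * K + 1) * H\<^sup>2" by (simp add: err_bound_def K_def algebra_simps)
      finally show "\<exists>(uh::real \<Rightarrow> real^'d) (lh::real \<Rightarrow> real).
              (\<lambda>y. uh y - herm3 a b M x uD y) \<in> S31D a b M x
            \<and> lh \<in> S20_0 a b M x
            \<and> (\<forall>v\<in>S31D a b M x. \<forall>mu\<in>S20_0 a b M x. Fh a b M x uh lh v mu = 0)
            \<and> H2norm a b (\<lambda>y. u y - uh y) \<le> (C * K + 1) * (meshsize M x)\<^sup>2"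
        using X lhS F unfolding H_def by blast
    qed
  qed
qed

end
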